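(* Let $F$ be a Frechet space, and let $A\subset F$ be countably rectifiable of positive codimension. Then $A$ is Baire-meager, Haar-null, and (if $F$ is separable) Aronszajn-null.
   Context: A Frechet space is a complete topological vector space whose topology is generated by a countable family of semi-norms (equivalently by a complete translation-invariant metric). Rectifiability in a Banach space $B$. A continuous linear map between Banach spaces is Fredholm of type $(k,l)$ if its kernel has finite dimension $k$ and its range is closed with finite codimension $l$. A subset $A\subset B$ is a Lipschitz graph of codimension $d$ if there exist a splitting $B=D\oplus T$ with $T$ a linear subspace of dimension $d$ and $D$ a closed linear subspace, a subset $D_1\subset D$ and a Lipschitz map $g:D_1\to T$ such that $A=\{x\oplus g(x):x\in D_1\}$. A set $A\subset B$ is rectifiable of codimension $d$ if there exist an integer $k\geq 0$, a Banach space $B_1$, a Fredholm linear map $P:B_1\to B$ of type $(k,0)$ and a Lipschitz graph $A_1\subset B_1$ of codimension $d+k$ with $A\subset P(A_1)$. Rectifiability in a Frechet space $F$. $A\subset F$ is rectifiable of codimension $d$ if there exist a Banach space $B$ and a continuous linear map $P:F\to B$ with dense range such that $P(A)$ is rectifiable of codimension $d$ in $B$; it is countably rectifiable of codimension $d$ if it is a countable union of rectifiable sets of codimension $d$. Positive codimension means $d\geq 1$. Small sets in $F$. $A$ is Baire-meager if it is contained in a countable union of closed sets with empty interior. $A$ is Haar-null if there is a compactly supported Borel probability measure $\mu$ on $F$ with $\mu(A+f)=0$ for all $f\in F$, meaning that $A+f$ is contained in a Borel set $\tilde A_f$ with $\mu(\tilde A_f)=0$. If $F$ is separable, $A$ is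 Aronszajn-null if for each sequence $(f_n)$ in $F$ whose linear span is dense in $F$ there is a sequence $(A_n)$ of Borel subsets of $F$ with $A\subset\bigcup_nA_n$ such that for each $f\in F$ and each $n$ the set $\{x\in\mathbb{R}:f+xf_n\in A_n\}$ has zero Lebesgue measure. *)

theory Defs
  imports "HOL-Analysis.Analysis"
begin

subsection \<open>Frechet spaces\<close>

definition (in real_vector) seminorm :: "('a \<Rightarrow> real) \<Rightarrow> bool" where
  "seminorm p \<longleftrightarrow>
     (\<forall>x y. p (x + y) \<le> p x + p y) \<and> (\<forall>c x. p (c *\<^sub>R x) = \<bar>c\<bar> * p x)"

class topological_real_vector = real_vector + topological_ab_group_add +
  assumes tendsto_scaleR_Pair:
    "LIM z (nhds c \<times>\<^sub>F nhds x). fst z *\<^sub>R snd z :> nhds (c *\<^sub>R x)"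

text \<open>
  Completeness is convergence of all Cauchy filters for the translation-invariant uniform
  structure of the group. The topology is Hausdorff, as it comes from a complete metric.
\<close>

class frechet_space = topological_real_vector + t2_space +
  assumes topology_from_seminorms:
    "\<exists>p :: nat \<Rightarrow> 'a \<Rightarrow> real. (\<forall>n. seminorm (p n)) \<and>
       open = generate_topology {{y. p n (y - x) < e} | n x e. e > 0}"
  and cauchy_filter_converges:
    "G \<noteq> bot \<Longrightarrow> LIM z (G \<times>\<^sub>F G). fst z - snd z :> nhds 0 \<Longrightarrow> \<exists>x. G \<le> nhds x"

subsection \<open>Rectifiable sets in Banach spaces\<close>

text \<open>
  The notion of rectifiability quantifies existentially over Banach spaces, which HOL cannot do
  over types. A Banach space is therefore a complete linear subspace of a normed space type, with
  the induced norm. This is no restriction once the type is arbitrary: every set of Banach spaces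
  embeds linearly and isometrically in a single normed space, their algebraic direct sum
  with the sum norm. Type arguments of the form \<^term>\<open>TYPE('b::real_normed_vector)\<close>
  name the ambient types in which the Banach spaces are sought; allowing subspaces instead of
  whole types lets different members of a family of sets use different Banach spaces.
\<close>

definition banach_subspace :: "'b::real_normed_vector set \<Rightarrow> bool" where
  "banach_subspace S \<longleftrightarrow> subspace S \<and> complete S"

definition linear_map_on ::
  "'c::real_vector set \<Rightarrow> 'b::real_vector set \<Rightarrow> ('c \<Rightarrow> 'b) \<Rightarrow> bool" where
  "linear_map_on S1 S P \<longleftrightarrow> P ` S1 \<subseteq> S \<and>
     (\<forall>x\<in>S1. \<forall>y\<in>S1. P (x + y) = P x + P y) \<and> (\<forall>c. \<forall>x\<in>S1. P (c *\<^sub>R x) = c *\<^sub>R P x)"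

text \<open>
  The library's \<^const>\<open>dim\<close> is not used, as it assigns the value 0 to infinite-dimensional
  spaces.
\<close>

definition has_finite_dim :: "'b::real_vector set \<Rightarrow> nat \<Rightarrow> bool" where
  "has_finite_dim T d \<longleftrightarrow>
     (\<exists>b. finite b \<and> independent b \<and> span b = T \<and> card b = d)"

definition direct_sum :: "'b::real_vector set \<Rightarrow> 'b set \<Rightarrow> 'b set \<Rightarrow> bool" where
  "direct_sum S D T \<longleftrightarrow> subspace D \<and> subspace T \<and>
     D \<inter> T = {0} \<and> S = {x + y | x y. x \<in> D \<and> y \<in> T}"

text \<open>
  Since the spaces concerned are complete, a subset is closed in them iff it is closed in the
  ambient type. Finite codimension is expressed by a complement of that dimension.
\<close>

definition fredholm ::
  "'c::real_normed_vector set \<Rightarrow> 'b::real_normed_vector set \<Rightarrow> ('c \<Rightarrow> 'b) \<Rightarrow> nat \<Rightarrow> nat \<Rightarrow> bool"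
where
  "fredholm S1 S P k l \<longleftrightarrow>
     linear_map_on S1 S P \<and> continuous_on S1 P \<and>
     has_finite_dim {x \<in> S1. P x = 0} k \<and>
     closed (P ` S1) \<and>
     (\<exists>C. direct_sum S (P ` S1) C \<and> has_finite_dim C l)"

definition lipschitz_graph :: "'b::real_normed_vector set \<Rightarrow> nat \<Rightarrow> 'b set \<Rightarrow> bool" where
  "lipschitz_graph S d A \<longleftrightarrow>
     (\<exists>D T D1 g L. direct_sum S D T \<and> closed D \<and> has_finite_dim T d \<and>
        D1 \<subseteq> D \<and> g ` D1 \<subseteq> T \<and> L-lipschitz_on D1 g \<and>
        A = {x + g x | x. x \<in> D1})"

definition rectifiable_banach ::
  "'c::real_normed_vector itself \<Rightarrow> 'b::real_normed_vector set \<Rightarrow> nat \<Rightarrow> 'b set \<Rightarrow> bool"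
where
  "rectifiable_banach _ S d A \<longleftrightarrow> A \<subseteq> S \<and>
     (\<exists>k (S1 :: 'c set) P A1. banach_subspace S1 \<and> fredholm S1 S P k 0 \<and>
        lipschitz_graph S1 (d + k) A1 \<and> A \<subseteq> P ` A1)"

subsection \<open>Rectifiable sets in Frechet spaces\<close>

definition rectifiable ::
  "'b::real_normed_vector itself \<Rightarrow> 'c::real_normed_vector itself \<Rightarrow>
   nat \<Rightarrow> 'f::frechet_space set \<Rightarrow> bool"
where
  "rectifiable _ C d A \<longleftrightarrow>
     (\<exists>(S :: 'b set) P. banach_subspace S \<and>
        linear_map_on UNIV S P \<and> continuous_on UNIV P \<and> S \<subseteq> closure (range P) \<and>
        rectifiable_banach C S d (P ` A))"

definition countably_rectifiable ::
  "'b::real_normed_vector itself \<Rightarrow> 'c::real_normed_vector itself \<Rightarrow>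
   nat \<Rightarrow> 'f::frechet_space set \<Rightarrow> bool"
where
  "countably_rectifiable B C d A \<longleftrightarrow>
     (\<exists>\<A>. countable \<A> \<and> (\<forall>X\<in>\<A>. rectifiable B C d X) \<and> A = \<Union>\<A>)"

subsection \<open>Small sets\<close>

definition baire_meager :: "'f::topological_space set \<Rightarrow> bool" where
  "baire_meager A \<longleftrightarrow>
     (\<exists>\<C>. countable \<C> \<and> (\<forall>C\<in>\<C>. closed C \<and> interior C = {}) \<and> A \<subseteq> \<Union>\<C>)"

definition haar_null :: "'f::frechet_space set \<Rightarrow> bool" where
  "haar_null A \<longleftrightarrow>
     (\<exists>\<mu> :: 'f measure. sets \<mu> = sets borel \<and> emeasure \<mu> (space \<mu>) = 1 \<and>
        (\<exists>K. compact K \<and> emeasure \<mu> (UNIV - K) = 0) \<and>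
        (\<forall>f. \<exists>N \<in> null_sets \<mu>. (\<lambda>a. a + f) ` A \<subseteq> N))"

definition aronszajn_null :: "'f::frechet_space set \<Rightarrow> bool" where
  "aronszajn_null A \<longleftrightarrow>
     (\<forall>f :: nat \<Rightarrow> 'f. closure (span (range f)) = UNIV \<longrightarrow>
        (\<exists>N :: nat \<Rightarrow> 'f set. (\<forall>n. N n \<in> sets borel) \<and> A \<subseteq> (\<Union>n. N n) \<and>
           (\<forall>v n. {x :: real. v + x *\<^sub>R f n \<in> N n} \<in> null_sets lebesgue)))"

end

theory Submission
  imports Defs "HOL-Probability.Infinite_Product_Measure"
begin

text \<open>
  Let \<open>P : F \<rightarrow> S\<close> have dense range, let \<open>Q : S1 \<rightarrow> S\<close> be onto with a kernel \<open>N\<close> of dimension \<open>k\<close>, and let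
  \<open>A1\<close> be a Lipschitz graph in \<open>S1\<close> of codimension \<open>p = d + k\<close> over a complement of \<open>T\<close>. Differences of points
  of \<open>A1\<close> stay outside a cone around \<open>T\<close>, and this survives both passing to the closure of \<open>A1\<close> and
  replacing a basis of \<open>T\<close> by nearby vectors \<open>w\<^sub>i\<close>. Since \<open>Q\<close> is open and \<open>P\<close> has dense range, the \<open>w\<^sub>i\<close> can be
  chosen with \<open>Q w\<^sub>i = P v\<^sub>i\<close>, where the \<open>v\<^sub>i\<close> come from any prescribed dense subset of \<open>F\<close>. If
  \<open>P (x + \<Sum> c\<^sub>i v\<^sub>i)\<close> lies in \<open>Q A1\<close>, then \<open>z + \<Sum> c\<^sub>i w\<^sub>i + n \<in> A1\<close> for some \<open>n \<in> N\<close>, where \<open>Q z = P x\<close>, and the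
  cone condition makes \<open>c\<close> a Lipschitz function of \<open>n\<close>. So the set of such \<open>c\<close> in \<open>p\<close>-space is a Lipschitz image
  of a part of \<open>k\<close>-space, and as \<open>d \<ge> 1\<close> it has measure zero (\<open>null_sets_of_lipschitz_coordinates\<close>).

  Cutting \<open>A1\<close> into bounded pieces makes the images under \<open>Q\<close> closed, because bounded parts of \<open>N\<close> are
  relatively compact. A rectifiable set is therefore covered by countably many closed sets \<open>C\<close> that are
  null along all translates of one finite family of directions: the predicate \<open>slice_null\<close>. The three conclusions
  only use such a cover. The tool that connects them is \<open>slice_null_span\<close>: by Fubini and translation
  invariance, nullity passes to every family whose span contains the given directions.

  \<^item> Meager: a null slice contains no open box, so \<open>C\<close> has empty interior.

  \<^item> Haar-null: a random convergent series \<open>\<Sum> c\<^sub>j u\<^sub>j\<close> with independent coefficients \<open>c\<^sub>j\<close> uniform on the unit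
    interval, whose vectors \<open>u\<^sub>j\<close> run through multiples of the directions of all the sets \<open>C\<close>, has a distribution
    that annihilates every translate of every \<open>C\<close>: condition on all but finitely many coefficients.

  \<^item> Aronszajn-null: the directions can be taken in the span of the given sequence, which is dense, and hence be replaced by
    an initial segment of it. One direction at a time is split off by Fubini: the points of \<open>C\<close> whose
    line in the last direction meets \<open>C\<close> in measure zero form one piece, and the other points are
    covered by countably many closed sets that are null along the remaining directions (\<open>slice_null_decomposition\<close>).
\<close>

section \<open>Null slices in finitely many directions\<close>

lemma continuous_on_scaleR_topological:
  fixes g :: "'a::topological_space \<Rightarrow> 'b::topological_real_vector"
  assumes "continuous_on S f" "continuous_on S g"
  shows "continuous_on S (\<lambda>x. f x *\<^sub>R g x)"
  unfolding continuous_on_def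
proof
  fix x assume x: "x \<in> S"
  have "LIM y (at x within S). (f y, g y) :> (nhds (f x) \<times>\<^sub>F nhds (g x))"
    using assms x by (intro filterlim_Pair) (auto simp: continuous_on_def)
  from filterlim_compose[OF tendsto_scaleR_Pair this]
  show "((\<lambda>y. f y *\<^sub>R g y) \<longlongrightarrow> f x *\<^sub>R g x) (at x within S)" by simp
qed

text \<open>
  The dimension \<open>p\<close> depends on the sets at hand, so Euclidean \<open>p\<close>-space is a product measure over
  \<open>{..<p}\<close> and not a type; its points are functions that are \<^const>\<open>undefined\<close> outside \<open>{..<p}\<close>.
\<close>
abbreviation lborel_pow :: "nat \<Rightarrow> (nat \<Rightarrow> real) measure" where
  "lborel_pow p \<equiv> PiM {..<p} (\<lambda>_. lborel)"

interpretation lborel_prod: product_sigma_finite "\<lambda>_::nat. lborel :: real measure"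
  by standard

text \<open>
  The Borel sets of \<open>nat \<Rightarrow> real\<close> with the product topology are those of the product \<open>\<sigma>\<close>-algebra. Viewing
  \<open>p\<close>-space inside \<open>nat \<Rightarrow> real\<close> hence gives measurability of preimages of closed sets under continuous maps into
  spaces \<open>F\<close> that need not be second countable.
\<close>
lemma measurable_id_lborel_pow: "(\<lambda>c. c) \<in> lborel_pow p \<rightarrow>\<^sub>M borel"
proof (rule measurable_coordinatewise_then_product)
  fix i
  show "(\<lambda>c. c i) \<in> borel_measurable (lborel_pow p)"
  proof (cases "i < p")
    case True
    then have "(\<lambda>c. c i) \<in> lborel_pow p \<rightarrow>\<^sub>M lborel"
      by (intro measurable_component_singleton) auto
    then show ?thesis by simp
  next
    case False
    then have "c i = undefined" if "c \<in> space (lborel_pow p)" for c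
      using that by (auto simp: space_PiM PiE_def extensional_def)
    then show ?thesis by (subst measurable_cong[where g="\<lambda>_. undefined"]) auto
  qed
qed

lemma borel_measurable_continuous_lborel_pow:
  fixes f :: "(nat \<Rightarrow> real) \<Rightarrow> 'a::topological_space"
  assumes "continuous_on UNIV f"
  shows "f \<in> lborel_pow p \<rightarrow>\<^sub>M borel"
  using measurable_compose[OF measurable_id_lborel_pow borel_measurable_continuous_onI[OF assms]] .

definition lincomb :: "nat \<Rightarrow> (nat \<Rightarrow> 'f::real_vector) \<Rightarrow> (nat \<Rightarrow> real) \<Rightarrow> 'f" where
  "lincomb p v c = (\<Sum>i<p. c i *\<^sub>R v i)"

lemma continuous_on_coord: "continuous_on S (\<lambda>c::nat \<Rightarrow> 'a::topological_space. c i)"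
  by (rule continuous_on_subset[OF continuous_on_product_coordinates subset_UNIV])

lemma continuous_on_lincomb:
  fixes v :: "nat \<Rightarrow> 'f::topological_real_vector"
  shows "continuous_on UNIV (lincomb p v)"
  unfolding lincomb_def[abs_def]
  by (rule continuous_on_sum)
     (rule continuous_on_scaleR_topological[OF continuous_on_coord continuous_on_const])

definition slice_null :: "'f::topological_real_vector set \<Rightarrow> nat \<Rightarrow> (nat \<Rightarrow> 'f) \<Rightarrow> bool" where
  "slice_null C p v \<longleftrightarrow>
     (\<forall>x. {c \<in> space (lborel_pow p). x + lincomb p v c \<in> C} \<in> null_sets (lborel_pow p))"

lemma slice_measurable:
  fixes C :: "'f::topological_real_vector set"
  assumes "closed C"
  shows "{c \<in> space (lborel_pow p). x + lincomb p v c \<in> C} \<in> sets (lborel_pow p)"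
proof -
  have "(\<lambda>c. x + lincomb p v c) \<in> lborel_pow p \<rightarrow>\<^sub>M borel"
    by (intro borel_measurable_continuous_lborel_pow continuous_on_add continuous_on_const continuous_on_lincomb)
  from measurable_sets[OF this borel_closed[OF assms]]
  have "(\<lambda>c. x + lincomb p v c) -` C \<inter> space (lborel_pow p) \<in> sets (lborel_pow p)" .
  also have "(\<lambda>c. x + lincomb p v c) -` C \<inter> space (lborel_pow p) =
      {c \<in> space (lborel_pow p). x + lincomb p v c \<in> C}" by blast
  finally show ?thesis .
qed

text \<open>
  The points of \<open>Z\<close> are Lipschitz functions of \<open>k < p\<close> bounded parameters \<open>e\<close>. The parameter cube falls into \<open>N ^ k\<close> cells
  of side \<open>2 B / N\<close>, and each cell accounts for a part of \<open>Z\<close> inside a box of volume of order \<open>N ^ (- p)\<close>, so that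
  the total volume is of order \<open>1 / N\<close>.
\<close>
lemma null_sets_of_lipschitz_coordinates:
  fixes e :: "(nat \<Rightarrow> real) \<Rightarrow> nat \<Rightarrow> real"
  assumes Z: "Z \<in> sets (lborel_pow p)" and kp: "k < p" and B: "B > 0" and K: "K \<ge> 0"
    and bounded: "\<And>c j. c \<in> Z \<Longrightarrow> j < k \<Longrightarrow> \<bar>e c j\<bar> < B"
    and lipschitz: "\<And>c c' i \<delta>. c \<in> Z \<Longrightarrow> c' \<in> Z \<Longrightarrow> i < p \<Longrightarrow>
       (\<And>j. j < k \<Longrightarrow> \<bar>e c j - e c' j\<bar> \<le> \<delta>) \<Longrightarrow> \<bar>c i - c' i\<bar> \<le> K * \<delta>"
  shows "Z \<in> null_sets (lborel_pow p)"
proof -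
  define H where "H = 2 * K * (2 * B)"
  have H: "H \<ge> 0" using B K by (simp add: H_def)
  have bound: "emeasure (lborel_pow p) Z \<le> ennreal (H ^ p / N)" if N: "N > 0" for N :: nat
  proof -
    define cell where "cell c = (\<lambda>j\<in>{..<k}. nat \<lfloor>(e c j + B) * N / (2 * B)\<rfloor>)" for c
    define Q where "Q = ({..<k} \<rightarrow>\<^sub>E {..<N})"
    define \<delta> where "\<delta> = 2 * B / N"
    have \<delta>: "\<delta> > 0" using B N by (simp add: \<delta>_def)
    have card: "card Q = N ^ k" "finite Q" unfolding Q_def by (auto simp: card_PiE intro: finite_PiE)
    have cell: "cell c \<in> Q" if c: "c \<in> Z" for c
    proof -
      have "nat \<lfloor>(e c j + B) * N / (2 * B)\<rfloor> < N" if "j < k" for j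
      proof -
        have "(e c j + B) < 2 * B" "0 \<le> e c j + B" using bounded[OF c that] by auto
        then have "(e c j + B) * N / (2 * B) < N" "0 \<le> (e c j + B) * N / (2 * B)"
          using B N by (simp_all add: pos_divide_less_eq mult.commute)
        then show ?thesis by linarith
      qed
      then show ?thesis unfolding Q_def cell_def by auto
    qed
    have close: "\<bar>c i - c' i\<bar> \<le> K * \<delta>" if c: "c \<in> Z" "c' \<in> Z" "cell c = cell c'" "i < p" for c c' i
    proof (rule lipschitz[OF c(1,2) c(4)])
      fix j assume j: "j < k"
      let ?u = "(e c j + B) * N / (2 * B)" and ?u' = "(e c' j + B) * N / (2 * B)"
      have "nat \<lfloor>?u\<rfloor> = nat \<lfloor>?u'\<rfloor>"
        using fun_cong[OF c(3), of j] j by (simp add: cell_def)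
      moreover have "?u \<ge> 0" "?u' \<ge> 0" using bounded[OF c(1) j] bounded[OF c(2) j] B by auto
      ultimately have "\<bar>?u - ?u'\<bar> \<le> 1" by linarith
      moreover have "?u - ?u' = (e c j - e c' j) / \<delta>" using B N by (simp add: \<delta>_def field_simps)
      ultimately have "\<bar>(e c j - e c' j) / \<delta>\<bar> \<le> 1" by metis
      then show "\<bar>e c j - e c' j\<bar> \<le> \<delta>" using \<delta> by (simp add: abs_divide)
    qed
    define rep where "rep q = (SOME c. c \<in> Z \<and> cell c = q)" for q
    define Box where "Box q = (\<Pi>\<^sub>E i\<in>{..<p}. {rep q i - K * \<delta>..rep q i + K * \<delta>})" for q
    have rep: "rep (cell c) \<in> Z \<and> cell (rep (cell c)) = cell c" if "c \<in> Z" for c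
      unfolding rep_def by (rule someI[of _ c]) (use that in auto)
    have sub: "Z \<subseteq> (\<Union>q\<in>Q. Box q)"
    proof
      fix c assume c: "c \<in> Z"
      have "c \<in> Box (cell c)" unfolding Box_def
      proof (rule PiE_I)
        fix i assume "i \<in> {..<p}"
        then have "\<bar>c i - rep (cell c) i\<bar> \<le> K * \<delta>" using close[of c "rep (cell c)" i] rep[OF c] c by auto
        then show "c i \<in> {rep (cell c) i - K * \<delta>..rep (cell c) i + K * \<delta>}" by auto
      next
        fix i assume "i \<notin> {..<p}"
        then show "c i = undefined"
          using sets.sets_into_space[OF Z] c by (auto simp: space_PiM PiE_def extensional_def)
      qed
      with cell[OF c] show "c \<in> (\<Union>q\<in>Q. Box q)" by auto
    qed
    have Box_sets: "Box q \<in> sets (lborel_pow p)" for q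
      unfolding Box_def by (intro sets_PiM_I_finite) auto
    have Box: "emeasure (lborel_pow p) (Box q) = ennreal ((H / N) ^ p)" for q
    proof -
      have HN: "H / N = 2 * (K * \<delta>)" by (simp add: H_def \<delta>_def)
      have side: "0 \<le> K * \<delta>" using K \<delta> by simp
      have "emeasure (lborel_pow p) (Box q) = (\<Prod>i<p. emeasure lborel {rep q i - K * \<delta>..rep q i + K * \<delta>})"
        unfolding Box_def by (subst lborel_prod.emeasure_PiM) auto
      also have "\<dots> = (\<Prod>i<p. ennreal (H / N))"
        using side by (simp add: HN)
      also have "\<dots> = ennreal ((H / N) ^ p)" using H by (simp add: ennreal_power)
      finally show ?thesis .
    qed
    have "emeasure (lborel_pow p) Z \<le> emeasure (lborel_pow p) (\<Union>q\<in>Q. Box q)"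
      by (rule emeasure_mono[OF sub]) (use card Box_sets in auto)
    also have "\<dots> \<le> (\<Sum>q\<in>Q. emeasure (lborel_pow p) (Box q))"
      by (rule emeasure_subadditive_finite) (use card Box_sets in auto)
    also have "\<dots> = (\<Sum>q\<in>Q. ennreal ((H / N) ^ p))" by (simp only: Box)
    also have "\<dots> = ennreal (real (N ^ k) * (H / N) ^ p)" using H card by (simp add: ennreal_mult ennreal_of_nat_eq_real_of_nat)
    also have "\<dots> \<le> ennreal (H ^ p / N)"
    proof (rule ennreal_leI)
      have "real N ^ Suc k \<le> real N ^ p" using kp N by (intro power_increasing) auto
      then have "real N ^ k * N / N ^ p \<le> 1" using N by (simp add: field_simps)
      then have "H ^ p * (real N ^ k * N / N ^ p) \<le> H ^ p" using H by (intro mult_left_le) auto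
      then show "real (N ^ k) * (H / N) ^ p \<le> H ^ p / N"
        using N by (simp add: field_simps)
    qed
    finally show ?thesis .
  qed
  have "emeasure (lborel_pow p) Z \<le> 0"
  proof (rule LIMSEQ_le_const)
    have "(\<lambda>N. H ^ p * inverse (real (Suc N))) \<longlonglongrightarrow> H ^ p * 0"
      by (intro tendsto_intros LIMSEQ_inverse_real_of_nat)
    then have "(\<lambda>N. ennreal (H ^ p / real (Suc N))) \<longlonglongrightarrow> ennreal 0"
      by (intro tendsto_ennrealI) (simp add: field_simps)
    then show "(\<lambda>N. ennreal (H ^ p / real (Suc N))) \<longlonglongrightarrow> 0" by simp
    show "\<exists>N. \<forall>n\<ge>N. emeasure (lborel_pow p) Z \<le> ennreal (H ^ p / real (Suc n))"
      using bound by blast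
  qed
  with Z show ?thesis by (auto simp: null_sets_def)
qed

section \<open>Changing the directions\<close>

lemma sigma_finite_lborel_pow: "sigma_finite_measure (lborel_pow p)"
  by (rule lborel_prod.sigma_finite) simp

lemma lborel_pow_translation:
  "distr (lborel_pow p) (lborel_pow p) (\<lambda>c. \<lambda>i\<in>{..<p}. c i + b i) = lborel_pow p"
proof (rule lborel_prod.PiM_eqI)
  have meas [measurable]: "(\<lambda>c. \<lambda>i\<in>{..<p}. c i + b i) \<in> lborel_pow p \<rightarrow>\<^sub>M lborel_pow p"
    by (rule measurable_restrict) measurable
  fix A :: "nat \<Rightarrow> real set" assume A: "\<And>i. i \<in> {..<p} \<Longrightarrow> A i \<in> sets lborel"
  have vim: "(\<lambda>c. \<lambda>i\<in>{..<p}. c i + b i) -` Pi\<^sub>E {..<p} A \<inter> space (lborel_pow p) =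
      (\<Pi>\<^sub>E i\<in>{..<p}. (\<lambda>t. t + b i) -` A i)"
    by (auto simp: space_PiM PiE_def Pi_def)
  have sets: "(\<lambda>t. t + b i) -` A i \<in> sets lborel" if "i < p" for i
  proof -
    have "(\<lambda>t. t + b i) \<in> borel \<rightarrow>\<^sub>M borel" by simp
    from measurable_sets[OF this, of "A i"] A[of i] that show ?thesis by simp
  qed
  have em: "emeasure lborel ((\<lambda>t. t + b i) -` A i) = emeasure lborel (A i)" if "i < p" for i
  proof -
    have "emeasure lborel (A i) = emeasure (distr lborel borel ((+) (b i))) (A i)"
      by (simp add: lborel_distr_plus)
    also have "\<dots> = emeasure lborel ((\<lambda>t. t + b i) -` A i)"
      using A[of i] that by (subst emeasure_distr) (auto simp: vimage_def add.commute)
    finally show ?thesis ..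
  qed
  have "emeasure (distr (lborel_pow p) (lborel_pow p) (\<lambda>c. \<lambda>i\<in>{..<p}. c i + b i)) (Pi\<^sub>E {..<p} A) =
      emeasure (lborel_pow p) (\<Pi>\<^sub>E i\<in>{..<p}. (\<lambda>t. t + b i) -` A i)"
    using A by (subst emeasure_distr) (auto intro!: sets_PiM_I_finite meas simp: vim)
  also have "\<dots> = (\<Prod>i<p. emeasure lborel ((\<lambda>t. t + b i) -` A i))"
    using sets by (subst lborel_prod.emeasure_PiM) auto
  also have "\<dots> = (\<Prod>i<p. emeasure lborel (A i))" using em by (intro prod.cong) auto
  finally show "emeasure (distr (lborel_pow p) (lborel_pow p) (\<lambda>c. \<lambda>i\<in>{..<p}. c i + b i)) (Pi\<^sub>E {..<p} A) =
      (\<Prod>i<p. emeasure lborel (A i))" .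
qed auto

lemma slice_null_translate:
  fixes C :: "'f::topological_real_vector set"
  assumes C: "closed C"
    and null: "{c \<in> space (lborel_pow p). x + lincomb p v b + lincomb p v c \<in> C} \<in> null_sets (lborel_pow p)"
  shows "{c \<in> space (lborel_pow p). x + lincomb p v c \<in> C} \<in> null_sets (lborel_pow p)"
proof -
  let ?T = "\<lambda>c. \<lambda>i\<in>{..<p}. c i + b i" and ?Z = "{c \<in> space (lborel_pow p). x + lincomb p v c \<in> C}"
  have meas: "?T \<in> lborel_pow p \<rightarrow>\<^sub>M lborel_pow p" by (rule measurable_restrict) measurable
  have lin: "lincomb p v (?T c) = lincomb p v b + lincomb p v c" for c
    by (simp add: lincomb_def scaleR_add_left sum.distrib)
  have "emeasure (lborel_pow p) ?Z = emeasure (distr (lborel_pow p) (lborel_pow p) ?T) ?Z"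
    by (simp add: lborel_pow_translation)
  also have "\<dots> = emeasure (lborel_pow p) (?T -` ?Z \<inter> space (lborel_pow p))"
    by (rule emeasure_distr[OF meas slice_measurable[OF C]])
  also have "?T -` ?Z \<inter> space (lborel_pow p) =
      {c \<in> space (lborel_pow p). x + lincomb p v b + lincomb p v c \<in> C}"
    using measurable_space[OF meas] by (auto simp: lin add.assoc)
  also have "emeasure (lborel_pow p) \<dots> = 0" using null by auto
  finally show ?thesis using slice_measurable[OF C] by (auto simp: null_sets_def)
qed

lemma lincomb_in_span:
  assumes "x \<in> span (w ` {..<n})"
  obtains a where "x = lincomb n w a"
proof -
  have "\<exists>a. x = lincomb n w a" using assms
  proof (induction rule: span_induct_alt)
    case base
    show ?case by (rule exI[of _ "\<lambda>_. 0"]) (simp add: lincomb_def)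
  next
    case (step c x y)
    then obtain a i where a: "y = lincomb n w a" and i: "x = w i" "i < n" by auto
    have "lincomb n w (\<lambda>j. a j + (if j = i then c else 0)) = y + c *\<^sub>R x"
      using i by (simp add: a lincomb_def scaleR_add_left sum.distrib if_distrib[of "\<lambda>t. t *\<^sub>R _"] cong: if_cong)
    then show ?case by (metis add.commute)
  qed
  with that show thesis by blast
qed

lemma lincomb_lincomb:
  assumes "\<And>i. i < p \<Longrightarrow> v i = lincomb n w (a i)"
  shows "lincomb p v b = lincomb n w (\<lambda>j. \<Sum>i<p. b i * a i j)"
proof -
  have "lincomb p v b = (\<Sum>i<p. \<Sum>j<n. (b i * a i j) *\<^sub>R w j)"
    using assms by (simp add: lincomb_def scaleR_sum_right)
  also have "\<dots> = (\<Sum>j<n. \<Sum>i<p. (b i * a i j) *\<^sub>R w j)" by (rule sum.swap)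
  finally show ?thesis by (simp add: lincomb_def scaleR_sum_left)
qed

text \<open>
  For each \<open>c\<close>, almost no \<open>b\<close> has \<open>x + \<Sum> b\<^sub>i v\<^sub>i + \<Sum> c\<^sub>j w\<^sub>j \<in> C\<close>. By Fubini there is one \<open>b\<close> for which almost no
  \<open>c\<close> has this property. As \<open>\<Sum> b\<^sub>i v\<^sub>i\<close> is a combination of the \<open>w\<^sub>j\<close>, the slice obtained for this \<open>b\<close> is a translate
  of the slice through \<open>x\<close>.
\<close>
lemma slice_null_span:
  fixes C :: "'f::topological_real_vector set"
  assumes C: "closed C" and null: "slice_null C p v"
    and span: "\<And>i. i < p \<Longrightarrow> v i \<in> span (w ` {..<n})"
  shows "slice_null C n w"
  unfolding slice_null_def
proof
  fix x
  have "\<exists>a. v i = lincomb n w a" if "i < p" for i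
    using lincomb_in_span[OF span[OF that]] by blast
  then obtain a where a: "\<And>i. i < p \<Longrightarrow> v i = lincomb n w (a i)" by metis
  interpret P: sigma_finite_measure "lborel_pow p" by (rule sigma_finite_lborel_pow)
  interpret N: sigma_finite_measure "lborel_pow n" by (rule sigma_finite_lborel_pow)
  interpret PN: pair_sigma_finite "lborel_pow p" "lborel_pow n" ..
  let ?g = "\<lambda>(b, c). x + lincomb p v b + lincomb n w c"
  define E where "E = ?g -` C \<inter> space (lborel_pow p \<Otimes>\<^sub>M lborel_pow n)"
  have E: "E \<in> sets (lborel_pow p \<Otimes>\<^sub>M lborel_pow n)"
  proof -
    have "(\<lambda>z. (fst z, snd z)) \<in> (lborel_pow p \<Otimes>\<^sub>M lborel_pow n) \<rightarrow>\<^sub>M (borel \<Otimes>\<^sub>M borel)"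
      by (intro measurable_Pair measurable_compose[OF measurable_fst measurable_id_lborel_pow]
          measurable_compose[OF measurable_snd measurable_id_lborel_pow])
    then have "(\<lambda>z. z) \<in> (lborel_pow p \<Otimes>\<^sub>M lborel_pow n) \<rightarrow>\<^sub>M borel" by (simp add: borel_prod)
    moreover have "continuous_on UNIV ?g"
      unfolding case_prod_beta
      by (intro continuous_on_add continuous_on_const continuous_on_compose2[OF continuous_on_lincomb]
          continuous_on_fst continuous_on_snd continuous_on_id subset_UNIV)
    ultimately have "?g \<in> (lborel_pow p \<Otimes>\<^sub>M lborel_pow n) \<rightarrow>\<^sub>M borel"
      by (rule measurable_compose[OF _ borel_measurable_continuous_onI])
    from measurable_sets[OF this borel_closed[OF C]] show ?thesis by (simp only: E_def)
  qed
  have "emeasure (lborel_pow p \<Otimes>\<^sub>M lborel_pow n) E =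
      (\<integral>\<^sup>+ c. emeasure (lborel_pow p) ((\<lambda>b. (b, c)) -` E) \<partial>lborel_pow n)"
    by (rule PN.emeasure_pair_measure_alt2[OF E])
  also have "\<dots> = (\<integral>\<^sup>+ c. 0 \<partial>lborel_pow n)"
  proof (rule nn_integral_cong)
    fix c assume "c \<in> space (lborel_pow n)"
    then have "(\<lambda>b. (b, c)) -` E =
        {b \<in> space (lborel_pow p). (x + lincomb n w c) + lincomb p v b \<in> C}"
      by (auto simp: E_def space_pair_measure add_ac)
    then show "emeasure (lborel_pow p) ((\<lambda>b. (b, c)) -` E) = 0"
      using null by (auto simp: slice_null_def)
  qed
  finally have "E \<in> null_sets (lborel_pow p \<Otimes>\<^sub>M lborel_pow n)" using E by (auto simp: null_sets_def)
  then have AE: "AE b in lborel_pow p. AE c in lborel_pow n. (b, c) \<notin> E"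
    by (intro PN.AE_pair AE_not_in)
  obtain b where b: "b \<in> space (lborel_pow p)" "AE c in lborel_pow n. (b, c) \<notin> E"
  proof (rule ccontr)
    assume "\<not> thesis"
    with that have "AE b in lborel_pow p. \<not> (AE c in lborel_pow n. (b, c) \<notin> E)" by (intro AE_I2) blast
    with AE have "AE b in lborel_pow p. \<not> True" by eventually_elim simp
    then have "emeasure (lborel_pow p) {b \<in> space (lborel_pow p). True} = 0"
      by (rule emeasure_eq_0_AE)
    moreover have "emeasure (lborel_pow p) (space (lborel_pow p)) \<noteq> 0"
      unfolding space_PiM by (subst lborel_prod.emeasure_PiM) (auto simp: prod_zero_iff)
    ultimately show False by simp
  qed
  let ?Z = "{c \<in> space (lborel_pow n). x + lincomb p v b + lincomb n w c \<in> C}"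
  have "emeasure (lborel_pow n) ?Z = 0"
    by (rule emeasure_eq_0_AE, rule AE_mp[OF b(2)], rule AE_I2)
       (use b(1) in \<open>auto simp: E_def space_pair_measure\<close>)
  then have "?Z \<in> null_sets (lborel_pow n)" using slice_measurable[OF C] by (auto simp: null_sets_def)
  then show "{c \<in> space (lborel_pow n). x + lincomb n w c \<in> C} \<in> null_sets (lborel_pow n)"
    by (subst (asm) lincomb_lincomb[where a=a and n=n and w=w]) (use a in \<open>auto intro: slice_null_translate[OF C]\<close>)
qed

lemma slice_null_empty_interior:
  fixes C :: "'f::topological_real_vector set"
  assumes null: "slice_null C p v"
  shows "interior C = {}"
proof (rule ccontr)
  assume "interior C \<noteq> {}"
  then obtain x where x: "x \<in> interior C" by blast
  let ?g = "\<lambda>c. x + lincomb p v c"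
  have "continuous_on UNIV ?g"
    by (intro continuous_on_add continuous_on_const continuous_on_lincomb)
  then have "open (?g -` interior C)" by (rule open_vimage[OF open_interior])
  then have "openin (product_topology (\<lambda>_. euclidean) UNIV) (?g -` interior C)"
    by (simp add: open_fun_def)
  moreover have "(\<lambda>_. 0) \<in> ?g -` interior C" using x by (simp add: lincomb_def)
  ultimately obtain X where X: "(\<lambda>_. 0) \<in> (\<Pi>\<^sub>E i\<in>UNIV. X i)" "\<And>i. open (X i)"
      "(\<Pi>\<^sub>E i\<in>UNIV. X i) \<subseteq> ?g -` interior C"
    using product_topology_open_contains_basis[of "\<lambda>_. euclidean" UNIV] by (metis open_openin)
  let ?Z = "{c \<in> space (lborel_pow p). x + lincomb p v c \<in> C}"
  have sub: "Pi\<^sub>E {..<p} X \<subseteq> ?Z"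
  proof
    fix c assume c: "c \<in> Pi\<^sub>E {..<p} X"
    define c' where "c' i = (if i < p then c i else 0)" for i
    have "c' \<in> (\<Pi>\<^sub>E i\<in>UNIV. X i)" using c X(1) by (auto simp: c'_def PiE_def Pi_def)
    with X(3) have "?g c' \<in> C" using interior_subset by blast
    moreover have "lincomb p v c' = lincomb p v c" by (simp add: lincomb_def c'_def)
    ultimately show "c \<in> ?Z" using c by (auto simp: space_PiM PiE_def)
  qed
  have Z: "?Z \<in> null_sets (lborel_pow p)" using null by (auto simp: slice_null_def)
  have "emeasure (lborel_pow p) (Pi\<^sub>E {..<p} X) \<le> emeasure (lborel_pow p) ?Z"
    using Z by (intro emeasure_mono sub) auto
  then have "emeasure (lborel_pow p) (Pi\<^sub>E {..<p} X) = 0" using Z by (auto simp: null_sets_def)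
  then have "(\<Prod>i<p. emeasure lborel (X i)) = 0"
    using X(2) by (subst (asm) lborel_prod.emeasure_PiM) auto
  then obtain i where "emeasure lborel (X i) = 0" by auto
  then have "X i \<in> null_sets lborel" using X(2)[of i] by (auto simp: null_sets_def)
  then have "negligible (X i)" by (simp add: negligible_iff_null_sets null_sets_completionI)
  moreover have "X i \<noteq> {}" using X(1) by auto
  ultimately show False using X(2)[of i] open_not_negligible by blast
qed

section \<open>Splitting a closed set along directions\<close>

lemma closed_line_slice:
  fixes C :: "'f::topological_real_vector set"
  assumes C: "closed C"
  shows "closed {t::real. x + t *\<^sub>R u \<in> C}"
proof -
  have "closed ((\<lambda>t. x + t *\<^sub>R u) -` C)"
    by (rule closed_vimage[OF C]) (intro continuous_on_add continuous_on_scaleR_topological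
      continuous_on_const continuous_on_id)
  then show ?thesis by (simp add: vimage_def)
qed

text \<open>
  The measure of a compact slice depends upper semicontinuously on the base point: an open set \<open>U\<close> that
  is slightly larger in measure than the slice at \<open>x\<close> contains, by compactness, all slices at nearby points.
  Closedness of these sets spares any discussion of joint measurability on the product of \<open>F\<close> and the line.
\<close>
lemma closed_fat_slices:
  fixes C :: "'f::topological_real_vector set"
  assumes C: "closed C"
  shows "closed {x. ennreal a \<le> emeasure lborel {t \<in> {-r..r}. x + t *\<^sub>R u \<in> C}}"
proof -
  let ?E = "\<lambda>x. {t \<in> {-r..r::real}. x + t *\<^sub>R u \<in> C}"
  have cont: "continuous_on UNIV (\<lambda>z::'f \<times> real. fst z + snd z *\<^sub>R u)"
    by (intro continuous_on_add continuous_on_scaleR_topological continuous_on_fst continuous_on_snd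
        continuous_on_const continuous_on_id)
  have openW: "open ((\<lambda>z::'f \<times> real. fst z + snd z *\<^sub>R u) -` (- C))"
    by (rule open_vimage[OF _ cont]) (use C in auto)
  have closedE: "closed (?E x)" for x
  proof -
    have "?E x = {-r..r} \<inter> {t. x + t *\<^sub>R u \<in> C}" by auto
    then show ?thesis using closed_line_slice[OF C, of x u] by (simp add: closed_Int)
  qed
  have "open {x. emeasure lborel (?E x) < ennreal a}"
  proof (rule Topological_Spaces.openI)
    fix x assume "x \<in> {x. emeasure lborel (?E x) < ennreal a}"
    then have x: "emeasure lborel (?E x) < ennreal a" by simp
    define m where "m = measure lborel (?E x)"
    have m: "emeasure lborel (?E x) = ennreal m" "m \<ge> 0"
      using order_less_le_trans[OF x top_greatest]
      by (simp_all add: m_def emeasure_eq_ennreal_measure less_top)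
    then have e: "a - m > 0" using x by (simp add: ennreal_less_iff)
    obtain U where U: "open U" "?E x \<subseteq> U" "emeasure lborel (U - ?E x) < ennreal (a - m)"
      using outer_regular_lborel[OF borel_closed[OF closedE] e] by blast
    have "emeasure lborel U \<le> emeasure lborel (?E x \<union> (U - ?E x))"
      by (rule emeasure_mono) (use U closedE[of x] in auto)
    also have "\<dots> \<le> emeasure lborel (?E x) + emeasure lborel (U - ?E x)"
      by (rule emeasure_subadditive) (use U closedE[of x] in auto)
    also have "\<dots> < ennreal m + ennreal (a - m)"
      unfolding m using U(3) by (simp add: ennreal_add_left_cancel_less)
    also have "\<dots> = ennreal a" using m(2) e by (simp flip: ennreal_plus)
    finally have Ua: "emeasure lborel U < ennreal a" .
    have "compact ({-r..r} - U)" by (rule compact_diff) (use U in auto)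
    moreover have "{x} \<times> ({-r..r} - U) \<subseteq> (\<lambda>z. fst z + snd z *\<^sub>R u) -` (- C)"
      using U(2) by auto
    ultimately have "\<exists>X0. x \<in> X0 \<and> open X0 \<and>
        X0 \<times> ({-r..r} - U) \<subseteq> (\<lambda>z. fst z + snd z *\<^sub>R u) -` (- C)"
      by (rule Elementary_Topology.tube_lemma[OF _ openW])
    then obtain X0 where X0: "x \<in> X0" "open X0"
        "X0 \<times> ({-r..r} - U) \<subseteq> (\<lambda>z. fst z + snd z *\<^sub>R u) -` (- C)"
      by blast
    have "emeasure lborel (?E y) < ennreal a" if "y \<in> X0" for y
    proof -
      have "?E y \<subseteq> U"
      proof
        fix t assume t: "t \<in> ?E y"
        show "t \<in> U"
        proof (rule ccontr)
          assume "t \<notin> U"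
          with t that have "(y, t) \<in> X0 \<times> ({-r..r} - U)" by simp
          with X0(3) have "(y, t) \<in> (\<lambda>z. fst z + snd z *\<^sub>R u) -` (- C)" by blast
          with t show False by simp
        qed
      qed
      then have "emeasure lborel (?E y) \<le> emeasure lborel U" by (rule emeasure_mono) (use U in auto)
      with Ua show ?thesis by simp
    qed
    with X0(1,2) show "\<exists>T. open T \<and> x \<in> T \<and> T \<subseteq> {x. emeasure lborel (?E x) < ennreal a}" by blast
  qed
  moreover have "- {x. ennreal a \<le> emeasure lborel (?E x)} = {x. emeasure lborel (?E x) < ennreal a}"
    by auto
  ultimately show ?thesis by (simp add: closed_def)
qed

text \<open>
  Longer intervals are tested against smaller thresholds, so that a single index covers both limits: a fixed
  interval is contained in all later ones and its slice is smaller than every threshold.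
\<close>
lemma line_null_if_not_fat:
  fixes C :: "'f::topological_real_vector set"
  assumes C: "closed C"
    and thin: "\<And>q::nat. emeasure lborel {t \<in> {-real q..real q}. x + t *\<^sub>R u \<in> C} < ennreal (1 / Suc q)"
  shows "{t::real. x + t *\<^sub>R u \<in> C} \<in> null_sets lborel"
proof -
  let ?E = "\<lambda>q::nat. {t \<in> {-real q..real q}. x + t *\<^sub>R u \<in> C}"
  have E_eq: "?E q = {-real q..real q} \<inter> {t. x + t *\<^sub>R u \<in> C}" for q by auto
  have E_meas [simp]: "?E q \<in> sets borel" for q
    unfolding E_eq by (intro borel_closed closed_Int closed_line_slice[OF C]) auto
  have "?E q \<in> null_sets lborel" for q
  proof -
    have "emeasure lborel (?E q) \<le> 0"
    proof (rule LIMSEQ_le_const)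
      have "(\<lambda>k. ennreal (inverse (real (Suc k)))) \<longlonglongrightarrow> ennreal 0"
        by (intro tendsto_ennrealI LIMSEQ_inverse_real_of_nat)
      then show "(\<lambda>k. ennreal (1 / real (Suc k))) \<longlonglongrightarrow> 0" by (simp add: inverse_eq_divide)
      have "emeasure lborel (?E q) \<le> ennreal (1 / Suc k)" if "q \<le> k" for k
      proof -
        have "emeasure lborel (?E q) \<le> emeasure lborel (?E k)"
        proof (rule emeasure_mono)
          show "?E k \<in> sets lborel" using E_meas[of k] by (simp only: sets_lborel)
        qed (use that in auto)
        with thin[of k] show ?thesis by simp
      qed
      then show "\<exists>N. \<forall>k\<ge>N. emeasure lborel (?E q) \<le> ennreal (1 / real (Suc k))" by blast
    qed
    then have "emeasure lborel (?E q) = 0" by (simp only: le_zero_eq)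
    moreover have "?E q \<in> sets lborel" using E_meas[of q] by (simp only: sets_lborel)
    ultimately show ?thesis by (rule null_setsI)
  qed
  then have "(\<Union>q. ?E q) \<in> null_sets lborel" by blast
  moreover have "(\<Union>q. ?E q) = {t. x + t *\<^sub>R u \<in> C}"
  proof (intro equalityI subsetI)
    fix t assume t: "t \<in> {t. x + t *\<^sub>R u \<in> C}"
    obtain q :: nat where "\<bar>t\<bar> \<le> q" using real_arch_simple by blast
    with t have "t \<in> ?E q" by auto
    then show "t \<in> (\<Union>q. ?E q)" by blast
  qed auto
  ultimately show ?thesis by simp
qed

lemma slice_null_Suc_AE:
  fixes C :: "'f::topological_real_vector set"
  assumes C: "closed C" and null: "slice_null C (Suc n) f"
  shows "AE c in lborel_pow n. emeasure lborel {t. (x + lincomb n f c) + t *\<^sub>R f n \<in> C} = 0"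
proof -
  let ?Z = "{c \<in> space (lborel_pow (Suc n)). x + lincomb (Suc n) f c \<in> C}"
  let ?L = "\<lambda>c. {t. (x + lincomb n f c) + t *\<^sub>R f n \<in> C}"
  have ins: "{..<Suc n} = insert n {..<n}" by auto
  have Z: "?Z \<in> sets (lborel_pow (Suc n))" by (rule slice_measurable[OF C])
  then have ind: "(indicator ?Z :: _ \<Rightarrow> ennreal) \<in> borel_measurable (PiM (insert n {..<n}) (\<lambda>_. lborel))"
    by (simp add: ins[symmetric])
  have inner: "(\<integral>\<^sup>+ t. indicator ?Z (c(n := t)) \<partial>lborel) = emeasure lborel (?L c)"
    if c: "c \<in> space (lborel_pow n)" for c
  proof -
    have "c(n := t) \<in> space (lborel_pow (Suc n))" for t
      using c by (auto simp: space_PiM PiE_def extensional_def)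
    moreover have "lincomb (Suc n) f (c(n := t)) = lincomb n f c + t *\<^sub>R f n" for t
      by (simp add: lincomb_def)
    ultimately have "indicator ?Z (c(n := t)) = (indicator (?L c) t :: ennreal)" for t
      by (auto simp: indicator_def add.assoc)
    then show ?thesis using closed_line_slice[OF C] by simp
  qed
  have "(\<integral>\<^sup>+ c. emeasure lborel (?L c) \<partial>lborel_pow n) =
      (\<integral>\<^sup>+ c. (\<integral>\<^sup>+ t. indicator ?Z (c(n := t)) \<partial>lborel) \<partial>lborel_pow n)"
    by (intro nn_integral_cong) (simp add: inner)
  also have "\<dots> = (\<integral>\<^sup>+ c. indicator ?Z c \<partial>lborel_pow (Suc n))"
    using lborel_prod.product_nn_integral_insert[OF _ _ ind] by (simp add: ins)
  also have "\<dots> = 0" using null Z by (auto simp: slice_null_def null_sets_def)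
  finally have int: "(\<integral>\<^sup>+ c. emeasure lborel (?L c) \<partial>lborel_pow n) = 0" .
  have "(\<lambda>c. \<integral>\<^sup>+ t. indicator ?Z (c(n := t)) \<partial>lborel) \<in> borel_measurable (lborel_pow n)"
  proof (rule lborel.borel_measurable_nn_integral)
    have "(\<lambda>(c, t). c(n := t)) \<in> lborel_pow n \<Otimes>\<^sub>M lborel \<rightarrow>\<^sub>M lborel_pow (Suc n)"
      unfolding ins by (rule measurable_add_dim)
    from measurable_compose[OF this borel_measurable_indicator[OF Z]]
    show "(\<lambda>(c, t). (indicator ?Z (c(n := t)) :: ennreal)) \<in> borel_measurable (lborel_pow n \<Otimes>\<^sub>M lborel)"
      by (simp add: split_beta')
  qed
  then have "(\<lambda>c. emeasure lborel (?L c)) \<in> borel_measurable (lborel_pow n)"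
    by (subst measurable_cong[OF inner[symmetric]])
  with int show ?thesis by (simp add: nn_integral_0_iff_AE)
qed

lemma slice_null_0_empty:
  assumes "slice_null C 0 f"
  shows "C = {}"
proof (rule ccontr)
  assume "C \<noteq> {}"
  then obtain x where "x \<in> C" by blast
  then have "{c \<in> space (lborel_pow 0). x + lincomb 0 f c \<in> C} = {\<lambda>_. undefined}"
    by (auto simp: lincomb_def space_PiM)
  then show False using assms[unfolded slice_null_def, rule_format, of x] emeasure_PiM_empty
    by (auto simp: null_sets_def)
qed

text \<open>
  By induction on the number of directions. \<open>F q\<close> is the closed set of points whose line in the last direction
  \<open>f n\<close> meets \<open>C\<close> in measure at least \<open>1 / (q + 1)\<close> within \<open>[-q, q]\<close>. Fubini makes \<open>F q\<close> null along the first \<open>n\<close>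
  directions, and what remains of \<open>C\<close> outside all \<open>F q\<close> is null along \<open>f n\<close>.
\<close>
lemma slice_null_decomposition:
  fixes C :: "'f::topological_real_vector set"
  assumes "closed C" and "slice_null C n f"
  shows "\<exists>N. C \<subseteq> (\<Union>j<n. N j) \<and>
    (\<forall>j<n. N j \<in> sets borel \<and> (\<forall>v. {t::real. v + t *\<^sub>R f j \<in> N j} \<in> null_sets lebesgue))"
  using assms
proof (induction n arbitrary: C)
  case 0
  then show ?case using slice_null_0_empty by auto
next
  case (Suc n)
  note C = Suc.prems(1)
  define F where "F q = {x. ennreal (1 / Suc q) \<le> emeasure lborel {t \<in> {-real q..real q}. x + t *\<^sub>R f n \<in> C}}"
    for q :: nat
  have F: "closed (F q)" for q unfolding F_def by (rule closed_fat_slices[OF C])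
  have "slice_null (F q) n f" for q
    unfolding slice_null_def
  proof
    fix x
    have "AE c in lborel_pow n. \<not> (x + lincomb n f c \<in> F q)"
      using slice_null_Suc_AE[OF C Suc.prems(2), of x]
    proof eventually_elim
      case (elim c)
      have "emeasure lborel {t \<in> {-real q..real q}. x + lincomb n f c + t *\<^sub>R f n \<in> C} \<le>
          emeasure lborel {t. x + lincomb n f c + t *\<^sub>R f n \<in> C}"
        by (rule emeasure_mono) (use closed_line_slice[OF C] in auto)
      with elim have "emeasure lborel {t \<in> {-real q..real q}. x + lincomb n f c + t *\<^sub>R f n \<in> C} = 0" by simp
      then show ?case by (simp add: F_def)
    qed
    then have "emeasure (lborel_pow n) {c \<in> space (lborel_pow n). x + lincomb n f c \<in> F q} = 0"
      by (rule emeasure_eq_0_AE)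
    then show "{c \<in> space (lborel_pow n). x + lincomb n f c \<in> F q} \<in> null_sets (lborel_pow n)"
      using slice_measurable[OF F] by (auto simp: null_sets_def)
  qed
  from Suc.IH[OF F this] obtain N where N: "\<And>q. F q \<subseteq> (\<Union>j<n. N q j)"
      "\<And>q j. j < n \<Longrightarrow> N q j \<in> sets borel"
      "\<And>q j v. j < n \<Longrightarrow> {t::real. v + t *\<^sub>R f j \<in> N q j} \<in> null_sets lebesgue"
    by metis
  define N' where "N' j = (if j < n then (\<Union>q. N q j) else C - (\<Union>q. F q))" for j
  have cover: "C \<subseteq> (\<Union>j<Suc n. N' j)"
  proof
    fix x assume x: "x \<in> C"
    show "x \<in> (\<Union>j<Suc n. N' j)"
    proof (cases "x \<in> (\<Union>q. F q)")
      case True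
      then obtain q j where "j < n" "x \<in> N q j" using N(1) by blast
      then have "j < Suc n" "x \<in> N' j" by (auto simp: N'_def)
      then show ?thesis by blast
    next
      case False
      with x have "x \<in> N' n" by (simp add: N'_def)
      then show ?thesis by blast
    qed
  qed
  have thin: "{t::real. v + t *\<^sub>R f n \<in> N' n} \<in> null_sets lebesgue" for v
  proof (cases "{t::real. v + t *\<^sub>R f n \<in> N' n} = {}")
    case False
    then obtain s where s: "v + s *\<^sub>R f n \<in> N' n" by blast
    let ?S = "{t. (v + s *\<^sub>R f n) + t *\<^sub>R f n \<in> C}"
    have "?S \<in> null_sets lborel"
      by (rule line_null_if_not_fat[OF C]) (use s in \<open>auto simp: N'_def F_def not_le\<close>)
    then have "{t. t - s \<in> ?S} \<in> null_sets lborel" by (rule null_sets_translation)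
    moreover have "{t. t - s \<in> ?S} = {t. v + t *\<^sub>R f n \<in> C}" by (simp add: scaleR_diff_left)
    ultimately have "{t. v + t *\<^sub>R f n \<in> C} \<in> null_sets lebesgue" by (simp add: null_sets_completionI)
    then show ?thesis by (rule null_sets_completion_subset[rotated]) (auto simp: N'_def)
  qed auto
  have "N' j \<in> sets borel \<and> (\<forall>v. {t::real. v + t *\<^sub>R f j \<in> N' j} \<in> null_sets lebesgue)"
    if j: "j < Suc n" for j
  proof (cases "j < n")
    case True
    have "{t::real. v + t *\<^sub>R f j \<in> N' j} = (\<Union>q. {t. v + t *\<^sub>R f j \<in> N q j})" for v
      using True by (auto simp: N'_def)
    then show ?thesis using True N by (auto simp: N'_def intro!: null_sets_UN)
  next
    case False
    with j have "j = n" by simp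
    moreover have "N' n \<in> sets borel" using C F by (auto simp: N'_def)
    ultimately show ?thesis using thin by simp
  qed
  with cover show ?case by blast
qed

section \<open>Random series in a Frechet space\<close>

lemma seminorm_zero: "seminorm p \<Longrightarrow> p 0 = 0"
  using scaleR_zero_left by (metis abs_0 mult_zero_left seminorm_def)

lemma seminorm_diff_commute: "seminorm p \<Longrightarrow> p (x - y) = p (y - x)"
  unfolding seminorm_def by (metis abs_minus abs_one minus_diff_eq mult_1 scaleR_minus1_left)

lemma seminorm_triangle_diff: "seminorm p \<Longrightarrow> p (x - z) \<le> p (x - y) + p (y - z)"
  unfolding seminorm_def by (metis diff_add_cancel add_diff_eq)

lemma seminorm_nonneg: "seminorm p \<Longrightarrow> 0 \<le> p x"
  using seminorm_triangle_diff[of p x x 0] seminorm_diff_commute[of p x 0] seminorm_zero[of p] by simp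

definition generating_seminorms :: "(nat \<Rightarrow> 'f::frechet_space \<Rightarrow> real) \<Rightarrow> bool" where
  "generating_seminorms p \<longleftrightarrow> (\<forall>k. seminorm (p k)) \<and>
     open = generate_topology {{y. p k (y - x) < e} | k x e. e > 0}"

lemma open_seminorm_ball:
  assumes "generating_seminorms p" and "e > 0"
  shows "open {y. p k (y - x) < e}"
proof -
  have "generate_topology {{y. p k (y - x) < e} | k x e. e > 0} {y. p k (y - x) < e}"
    by (rule generate_topology.Basis) (use assms(2) in blast)
  with assms(1) show ?thesis by (simp add: generating_seminorms_def)
qed

lemma tendsto_if_seminorms_tendsto:
  assumes p: "generating_seminorms p"
    and g: "\<And>k e. e > 0 \<Longrightarrow> eventually (\<lambda>z. p k (g z - l) < e) F"
  shows "(g \<longlongrightarrow> l) F"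
proof (rule topological_tendstoI)
  fix S assume "open S" "l \<in> S"
  then have "generate_topology {{y. p k (y - x) < e} | k x e. e > 0} S"
    using p by (simp add: generating_seminorms_def)
  then show "eventually (\<lambda>z. g z \<in> S) F" using \<open>l \<in> S\<close>
  proof induction
    case UNIV
    then show ?case by simp
  next
    case (Int a b)
    then show ?case by (auto intro: eventually_conj)
  next
    case (UN K)
    then obtain k where k: "k \<in> K" "l \<in> k" by blast
    with UN have "eventually (\<lambda>z. g z \<in> k) F" by blast
    then show ?case by eventually_elim (use k in blast)
  next
    case (Basis s)
    then obtain k x e where s: "s = {y. p k (y - x) < e}" by blast
    with Basis have "e - p k (l - x) > 0" by simp
    from g[OF this, of k] show ?case
    proof eventually_elim
      case (elim z)
      have "seminorm (p k)" using p by (simp add: generating_seminorms_def)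
      from seminorm_triangle_diff[OF this, of "g z" x l] elim show ?case by (simp add: s)
    qed
  qed
qed

text \<open>
  Clamping the coefficients to the unit interval lets the sum of the series below be continuous on the whole
  space \<open>nat \<Rightarrow> real\<close>, not only on the unit cube that carries the measure.
\<close>
definition clamp01 :: "real \<Rightarrow> real" where
  "clamp01 t = min 1 (max 0 t)"

lemma clamp01_bounds: "0 \<le> clamp01 t" "clamp01 t \<le> 1"
  by (auto simp: clamp01_def)

lemma clamp01_id: "0 \<le> t \<Longrightarrow> t \<le> 1 \<Longrightarrow> clamp01 t = t"
  by (auto simp: clamp01_def)

lemma continuous_on_clamp01_coords:
  "continuous_on UNIV (\<lambda>c :: nat \<Rightarrow> real. \<lambda>i. clamp01 (c i))"
  unfolding clamp01_def
  by (intro continuous_on_coordinatewise_then_product continuous_on_min continuous_on_max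
      continuous_on_const continuous_on_product_coordinates)

lemma continuous_on_lincomb_clamp01:
  fixes v :: "nat \<Rightarrow> 'f::topological_real_vector"
  shows "continuous_on UNIV (\<lambda>c. lincomb n v (\<lambda>i. clamp01 (c i)))"
  by (rule continuous_on_compose2[OF continuous_on_lincomb continuous_on_clamp01_coords subset_UNIV])

text \<open>
  The factors \<open>s j\<close> make the seminorms of \<open>s j *\<^sub>R u j\<close> with index up to \<open>j\<close> at most \<open>2 ^ (- j)\<close>. Each seminorm of the tails is then
  bounded by a geometric series uniformly in the coefficients, which yields convergence by completeness
  and continuity of the sum as a uniform limit.
\<close>
lemma clamped_series_exists:
  fixes u :: "nat \<Rightarrow> 'f::frechet_space"
  obtains s \<phi> where "\<And>j. s j > 0" "continuous_on UNIV \<phi>"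
    "\<And>c. (\<lambda>n. lincomb n (\<lambda>j. s j *\<^sub>R u j) (\<lambda>i. clamp01 (c i))) \<longlonglongrightarrow> \<phi> c"
proof -
  obtain p :: "nat \<Rightarrow> 'f \<Rightarrow> real" where gen: "generating_seminorms p"
    unfolding generating_seminorms_def by (rule exE[OF topology_from_seminorms])
  then have p: "seminorm (p k)" for k by (simp add: generating_seminorms_def)
  note conv = tendsto_if_seminorms_tendsto[OF gen] and op = open_seminorm_ball[OF gen]
  define s where "s j = (1/2) ^ j / (1 + (\<Sum>k\<le>j. p k (u j)))" for j
  have sum_nonneg: "0 \<le> (\<Sum>k\<le>j. p k (u j))" for j by (intro sum_nonneg seminorm_nonneg p)
  have s: "s j > 0" for j using sum_nonneg[of j] by (simp add: s_def)
  define w where "w j = s j *\<^sub>R u j" for j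
  have w: "p k (w j) \<le> (1/2) ^ j" if "k \<le> j" for k j
  proof -
    have "p k (u j) \<le> (\<Sum>k\<le>j. p k (u j))"
      using that by (intro member_le_sum seminorm_nonneg p) auto
    then have "(1/2) ^ j * p k (u j) \<le> (1/2) ^ j * (1 + (\<Sum>k\<le>j. p k (u j)))"
      by (intro mult_left_mono) auto
    then have "s j * p k (u j) \<le> (1/2) ^ j"
      using sum_nonneg[of j] by (simp add: s_def divide_le_eq)
    then show ?thesis using p[of k] s[of j] by (simp add: w_def seminorm_def)
  qed
  define S where "S n c = lincomb n w (\<lambda>i. clamp01 (c i))" for n and c :: "nat \<Rightarrow> real"
  have step: "p k (S m c - S n c) \<le> 2 * (1/2) ^ n - 2 * (1/2) ^ m" if "k \<le> n" "n \<le> m" for k n m c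
    using that(2)
  proof (induction m rule: dec_induct)
    case base
    then show ?case by (simp add: seminorm_zero[OF p])
  next
    case (step m)
    have "p k (S (Suc m) c - S m c) = clamp01 (c m) * p k (w m)"
      using p[of k] clamp01_bounds(1)[of "c m"] by (simp add: S_def lincomb_def seminorm_def)
    also have "\<dots> \<le> 1 * p k (w m)"
      by (intro mult_right_mono clamp01_bounds seminorm_nonneg p)
    also have "\<dots> \<le> (1/2) ^ m" using w[of k m] that(1) step by simp
    finally show ?case
      using step.IH seminorm_triangle_diff[OF p[of k], of "S (Suc m) c" "S n c" "S m c"] by simp
  qed
  have cauchy: "p k (S m c - S n c) \<le> 2 * (1/2) ^ n" if "k \<le> n" "n \<le> m" for k n m c
    using step[OF that, of c] by (rule order_trans) simp
  have small: "\<exists>n\<ge>k. 2 * (1/2) ^ n < e" if "e > 0" for k and e :: real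
  proof -
    have "(\<lambda>n. 2 * (1/2) ^ n :: real) \<longlonglongrightarrow> 2 * 0"
      by (intro tendsto_mult tendsto_const LIMSEQ_power_zero) simp
    then have "eventually (\<lambda>n. 2 * (1/2) ^ n < e) sequentially"
      using that by (intro order_tendstoD) auto
    then obtain N where "\<And>n. n \<ge> N \<Longrightarrow> 2 * (1/2) ^ n < e" by (auto simp: eventually_sequentially)
    then show ?thesis by (intro exI[of _ "max k N"]) auto
  qed
  have "\<exists>l. (\<lambda>n. S n c) \<longlonglongrightarrow> l" for c
  proof -
    let ?G = "filtermap (\<lambda>n. S n c) sequentially"
    have "((\<lambda>z. fst z - snd z) \<longlongrightarrow> 0) (?G \<times>\<^sub>F ?G)"
    proof (rule conv)
      fix k and e :: real assume "e > 0"
      then obtain N where N: "N \<ge> k" "2 * (1/2) ^ N < e / 2" using small[of "e / 2" k] by auto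
      have "p k (S m c - S n c) < e" if "N \<le> m" "N \<le> n" for m n
        using seminorm_triangle_diff[OF p[of k], of "S m c" "S n c" "S N c"]
          seminorm_diff_commute[OF p[of k], of "S N c" "S n c"] cauchy[OF N(1) that(1), of c]
          cauchy[OF N(1) that(2), of c] N(2) by simp
      then have "\<forall>x y. x \<in> (\<lambda>n. S n c) ` {N..} \<longrightarrow> y \<in> (\<lambda>n. S n c) ` {N..} \<longrightarrow> p k (x - y) < e" by auto
      moreover have "eventually (\<lambda>x. x \<in> (\<lambda>n. S n c) ` {N..}) ?G"
        unfolding eventually_filtermap by (auto intro: eventually_mono[OF eventually_ge_at_top[of N]])
      ultimately show "eventually (\<lambda>z. p k (fst z - snd z - 0) < e) (?G \<times>\<^sub>F ?G)"
        unfolding eventually_prod_filter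
        by (intro exI[of _ "\<lambda>x. x \<in> (\<lambda>n. S n c) ` {N..}"]) auto
    qed
    then obtain l where "?G \<le> nhds l"
      using cauchy_filter_converges[of ?G] by (auto simp: filtermap_bot_iff)
    then show ?thesis by (auto simp: filterlim_def)
  qed
  then obtain \<phi> where \<phi>: "\<And>c. (\<lambda>n. S n c) \<longlonglongrightarrow> \<phi> c" by metis
  have tail: "p k (\<phi> c - S n c) \<le> 2 * (1/2) ^ n" if "k \<le> n" for k n c
  proof (rule field_le_epsilon)
    fix e :: real assume "e > 0"
    then have "eventually (\<lambda>m. S m c \<in> {y. p k (y - \<phi> c) < e}) sequentially"
      using \<phi>[of c] op[OF \<open>e > 0\<close>, of k "\<phi> c"] by (intro topological_tendstoD) (auto simp: seminorm_zero[OF p])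
    then obtain M where "\<And>m. m \<ge> M \<Longrightarrow> p k (S m c - \<phi> c) < e"
      by (auto simp: eventually_sequentially)
    then obtain m where m: "m \<ge> n" "p k (S m c - \<phi> c) < e" by (metis max.cobounded1 max.cobounded2)
    then show "p k (\<phi> c - S n c) \<le> 2 * (1/2) ^ n + e"
      using seminorm_triangle_diff[OF p[of k], of "\<phi> c" "S n c" "S m c"]
        seminorm_diff_commute[OF p[of k], of "S m c" "\<phi> c"] cauchy[OF that m(1), of c] by simp
  qed
  have "(\<phi> \<longlongrightarrow> \<phi> c0) (at c0)" for c0
  proof (rule conv)
    fix k and e :: real assume "e > 0"
    then obtain N where N: "N \<ge> k" "2 * (1/2) ^ N < e / 3" using small[of "e / 3" k] by auto
    have "(S N \<longlongrightarrow> S N c0) (at c0)"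
      using continuous_on_lincomb_clamp01[of N w] unfolding S_def[abs_def]
      by (simp add: continuous_on_def)
    then have "eventually (\<lambda>c. S N c \<in> {y. p k (y - S N c0) < e / 3}) (at c0)"
      using op[of "e / 3" k "S N c0"] \<open>e > 0\<close>
      by (intro topological_tendstoD) (auto simp: seminorm_zero[OF p])
    then show "eventually (\<lambda>c. p k (\<phi> c - \<phi> c0) < e) (at c0)"
    proof eventually_elim
      case (elim c)
      then show ?case
        using seminorm_triangle_diff[OF p[of k], of "\<phi> c" "\<phi> c0" "S N c"]
          seminorm_triangle_diff[OF p[of k], of "S N c" "\<phi> c0" "S N c0"]
          seminorm_diff_commute[OF p[of k], of "S N c0" "\<phi> c0"] tail[OF N(1), of c] tail[OF N(1), of c0] N(2)
        by simp
    qed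
  qed
  then have "continuous_on UNIV \<phi>" by (simp add: continuous_on_def)
  with s \<phi> show thesis using that unfolding S_def w_def by blast
qed

section \<open>Haar-null sets\<close>

abbreviation unit_uniform :: "real measure" where
  "unit_uniform \<equiv> uniform_measure lborel {0..1}"

lemma prob_space_unit_uniform: "prob_space unit_uniform"
  by (rule prob_space_uniform_measure) auto

lemma PiM_unit_uniform:
  "uniform_measure (lborel_pow n) (\<Pi>\<^sub>E i\<in>{..<n}. {0..1}) = PiM {..<n} (\<lambda>_. unit_uniform)"
proof -
  interpret P: prob_space unit_uniform by (rule prob_space_unit_uniform)
  interpret U: product_sigma_finite "\<lambda>_::nat. unit_uniform" by standard
  show ?thesis
  proof (rule U.PiM_eqI)
    show "sets (uniform_measure (lborel_pow n) (\<Pi>\<^sub>E i\<in>{..<n}. {0..1})) =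
        sets (PiM {..<n} (\<lambda>_. unit_uniform))"
      by (simp cong: sets_PiM_cong)
  next
    fix A :: "nat \<Rightarrow> real set" assume A: "\<And>i. i \<in> {..<n} \<Longrightarrow> A i \<in> sets unit_uniform"
    have cube: "(\<Pi>\<^sub>E i\<in>{..<n}. {0..1::real}) \<in> sets (lborel_pow n)"
      by (intro sets_PiM_I_finite) auto
    have "emeasure (lborel_pow n) (\<Pi>\<^sub>E i\<in>{..<n}. {0..1}) = 1"
      by (subst lborel_prod.emeasure_PiM) auto
    moreover have "emeasure (lborel_pow n) ((\<Pi>\<^sub>E i\<in>{..<n}. {0..1}) \<inter> Pi\<^sub>E {..<n} A) =
        (\<Prod>i<n. emeasure lborel ({0..1} \<inter> A i))"
      unfolding PiE_Int by (subst lborel_prod.emeasure_PiM) (use A in auto)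
    moreover have "Pi\<^sub>E {..<n} A \<in> sets (lborel_pow n)"
      using A by (intro sets_PiM_I_finite) auto
    ultimately show "emeasure (uniform_measure (lborel_pow n) (\<Pi>\<^sub>E i\<in>{..<n}. {0..1})) (Pi\<^sub>E {..<n} A) =
        (\<Prod>i<n. emeasure unit_uniform (A i))"
      using A cube by (simp add: emeasure_uniform_measure divide_ennreal_def)
  qed simp
qed

lemma slice_null_uniform:
  fixes C :: "'f::topological_real_vector set"
  assumes C: "closed C" and null: "slice_null C n w"
  shows "emeasure (PiM UNIV (\<lambda>_. unit_uniform))
    {c. x + lincomb n w (\<lambda>i. clamp01 (c i)) \<in> C} = 0"
proof -
  interpret product_prob_space "\<lambda>_::nat. unit_uniform" UNIV
    unfolding product_prob_space_def product_prob_space_axioms_def product_sigma_finite_def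
    using prob_space_unit_uniform prob_space_imp_sigma_finite by blast
  let ?U = "PiM {..<n} (\<lambda>_. unit_uniform)"
  let ?Y = "{c \<in> space (lborel_pow n). x + lincomb n w (\<lambda>i. clamp01 (c i)) \<in> C}"
  let ?cube = "\<Pi>\<^sub>E i\<in>{..<n}. {0..1::real}"
  have cube: "?cube \<in> sets (lborel_pow n)" by (intro sets_PiM_I_finite) auto
  have "(\<lambda>c. x + lincomb n w (\<lambda>i. clamp01 (c i))) \<in> lborel_pow n \<rightarrow>\<^sub>M borel"
    by (intro borel_measurable_continuous_lborel_pow continuous_on_add continuous_on_const
        continuous_on_lincomb_clamp01)
  from measurable_sets[OF this borel_closed[OF C]]
  have Y: "?Y \<in> sets (lborel_pow n)"
    by (rule back_subst[of "\<lambda>Z. Z \<in> sets (lborel_pow n)"]) blast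
  have eq: "emb UNIV {..<n} ?Y = {c. x + lincomb n w (\<lambda>i. clamp01 (c i)) \<in> C}"
    by (auto simp: prod_emb_def space_PiM lincomb_def)
  have YU: "?Y \<in> sets ?U" using Y by (simp cong: sets_PiM_cong)
  have "emeasure (PiM UNIV (\<lambda>_. unit_uniform)) (emb UNIV {..<n} ?Y) = emeasure ?U ?Y"
    by (rule emeasure_PiM_emb') (use YU in auto)
  also have "\<dots> = emeasure (lborel_pow n) (?cube \<inter> ?Y) / emeasure (lborel_pow n) ?cube"
    unfolding PiM_unit_uniform[symmetric] by (rule emeasure_uniform_measure[OF cube Y])
  also have "emeasure (lborel_pow n) (?cube \<inter> ?Y) = 0"
  proof -
    have "lincomb n w (\<lambda>i. clamp01 (c i)) = lincomb n w c" if "c \<in> ?cube" for c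
      unfolding lincomb_def
      by (intro sum.cong refl arg_cong2[where f=scaleR] clamp01_id) (use that in \<open>auto simp: PiE_def Pi_def\<close>)
    then have "?cube \<inter> ?Y \<subseteq> {c \<in> space (lborel_pow n). x + lincomb n w c \<in> C}" by auto
    then have "emeasure (lborel_pow n) (?cube \<inter> ?Y) \<le>
        emeasure (lborel_pow n) {c \<in> space (lborel_pow n). x + lincomb n w c \<in> C}"
      by (rule emeasure_mono) (rule slice_measurable[OF C])
    with null show ?thesis by (auto simp: slice_null_def null_sets_def)
  qed
  finally show ?thesis by (simp add: eq)
qed

text \<open>
  This contains the fact that a countable union of Haar-null sets of this kind is Haar-null, so one measure
  must serve all \<open>C i\<close>. Given \<open>i\<close>, choose \<open>n\<close> so large that the first \<open>n\<close> vectors of the series span the directions of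
  \<open>C i\<close>. For fixed coefficients from index \<open>n\<close> on, the first \<open>n\<close> coefficients hit a translate of \<open>C i\<close> with probability
  zero.
\<close>
lemma slice_null_imp_haar_null:
  fixes A :: "'f::frechet_space set" and C :: "nat \<Rightarrow> 'f set"
  assumes C: "\<And>i. closed (C i)" and null: "\<And>i. slice_null (C i) (p i) (v i)"
    and cover: "A \<subseteq> (\<Union>i. C i)"
  shows "haar_null A"
proof -
  \<comment> \<open>A single sequence lists the directions of all \<open>C i\<close>.\<close>
  define u where "u n = (case prod_decode n of (i, j) \<Rightarrow> v i j)" for n
  obtain s \<phi> where s: "\<And>j. s j > 0" and cont: "continuous_on UNIV \<phi>"
    and lim: "\<And>c. (\<lambda>n. lincomb n (\<lambda>j. s j *\<^sub>R u j) (\<lambda>i. clamp01 (c i))) \<longlonglongrightarrow> \<phi> c"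
    using clamped_series_exists[of u] by blast
  define w where "w j = s j *\<^sub>R u j" for j
  note lim = lim[folded w_def]
  interpret sequence_space unit_uniform
    unfolding sequence_space_def product_prob_space_def product_prob_space_axioms_def product_sigma_finite_def
    using prob_space_unit_uniform prob_space_imp_sigma_finite by blast
  interpret SS: pair_sigma_finite S S ..
  have sets_S: "sets S = sets borel"
    by (subst sets_PiM_equal_borel[symmetric]) (simp cong: sets_PiM_cong)
  have space_S: "space S = UNIV" by (simp add: space_PiM)
  have space_SS: "space (S \<Otimes>\<^sub>M S) = UNIV" by (simp add: space_pair_measure space_S)
  have \<phi>_meas [measurable]: "\<phi> \<in> S \<rightarrow>\<^sub>M borel"
    using borel_measurable_continuous_onI[OF cont] by (simp cong: measurable_cong_sets add: measurable_cong_sets[OF sets_S refl])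
  \<comment> \<open>The sum depends on the first \<open>n\<close> coefficients through a finite combination only.\<close>
  have split: "\<phi> (comb_seq n c c') = \<phi> (comb_seq n (\<lambda>_. 0) c') + lincomb n w (\<lambda>i. clamp01 (c i))" for n c c'
  proof (rule LIMSEQ_unique[OF lim])
    have "lincomb m w (\<lambda>i. clamp01 (comb_seq n c c' i)) =
        lincomb m w (\<lambda>i. clamp01 (comb_seq n (\<lambda>_. 0) c' i)) + lincomb n w (\<lambda>i. clamp01 (c i))"
      if "n \<le> m" for m
    proof -
      have "lincomb n w (\<lambda>i. clamp01 (c i)) =
          (\<Sum>i<m. (if i < n then clamp01 (c i) *\<^sub>R w i else 0))"
        unfolding lincomb_def using that by (intro sum.mono_neutral_cong_left) auto
      then show ?thesis
        unfolding lincomb_def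
        by (simp add: sum.distrib[symmetric] comb_seq_def clamp01_def cong: if_cong)
           (intro sum.cong, auto)
    qed
    then show "(\<lambda>m. lincomb m w (\<lambda>i. clamp01 (comb_seq n c c' i))) \<longlonglongrightarrow>
        \<phi> (comb_seq n (\<lambda>_. 0) c') + lincomb n w (\<lambda>i. clamp01 (c i))"
      by (intro Lim_transform_eventually[OF tendsto_add[OF lim tendsto_const]])
         (use eventually_ge_at_top[of n] in eventually_elim, simp)
  qed
  have key: "emeasure S {c. x + \<phi> c \<in> C i} = 0" for x i
  proof -
    obtain n where n: "\<And>j. j < p i \<Longrightarrow> prod_encode (i, j) < n"
    proof
      fix j assume "j < p i"
      then show "prod_encode (i, j) < Suc (\<Sum>j<p i. prod_encode (i, j))"
        by (intro le_imp_less_Suc member_le_sum[of j "{..<p i}" "\<lambda>j. prod_encode (i, j)"]) auto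
    qed
    have "v i j \<in> span (w ` {..<n})" if "j < p i" for j
    proof -
      let ?k = "prod_encode (i, j)"
      have "v i j = (1 / s ?k) *\<^sub>R w ?k" using s[of ?k] by (simp add: w_def u_def)
      moreover have "w ?k \<in> span (w ` {..<n})" using n[OF that] by (intro span_base) auto
      ultimately show ?thesis by (metis span_scale)
    qed
    then have null_n: "slice_null (C i) n w" by (rule slice_null_span[OF C null])
    let ?Z = "{c. x + \<phi> c \<in> C i}"
    have Z: "?Z \<in> sets S"
    proof -
      have "closed ((\<lambda>c. x + \<phi> c) -` C i)"
        by (rule closed_vimage[OF C]) (intro continuous_on_add continuous_on_const cont)
      then show ?thesis by (simp add: sets_S vimage_def)
    qed
    let ?comb = "\<lambda>(c, c'). comb_seq n c c'"
    let ?E = "?comb -` ?Z \<inter> space (S \<Otimes>\<^sub>M S)"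
    have comb: "?comb \<in> S \<Otimes>\<^sub>M S \<rightarrow>\<^sub>M S" by (rule measurable_comb_seq)
    have E: "?E \<in> sets (S \<Otimes>\<^sub>M S)" by (rule measurable_sets[OF comb Z])
    have "emeasure S ?Z = emeasure (distr (S \<Otimes>\<^sub>M S) S ?comb) ?Z" by (simp only: PiM_comb_seq)
    also have "\<dots> = emeasure (S \<Otimes>\<^sub>M S) ?E" by (rule emeasure_distr[OF comb Z])
    also have "\<dots> = (\<integral>\<^sup>+ c'. emeasure S ((\<lambda>c. (c, c')) -` ?E) \<partial>S)"
      by (rule SS.emeasure_pair_measure_alt2[OF E])
    also have "\<dots> = (\<integral>\<^sup>+ c'. 0 \<partial>S)"
    proof (rule nn_integral_cong)
      fix c'
      have shift: "x + \<phi> (comb_seq n c c') =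
          (x + \<phi> (comb_seq n (\<lambda>_. 0) c')) + lincomb n w (\<lambda>i. clamp01 (c i))" for c
        by (subst split) (simp only: add.assoc)
      have "(\<lambda>c. (c, c')) -` ?E = {c. x + \<phi> (comb_seq n c c') \<in> C i}"
        by (simp only: space_SS vimage_def Int_UNIV_right mem_Collect_eq prod.case)
      also have "\<dots> = {c. (x + \<phi> (comb_seq n (\<lambda>_. 0) c')) + lincomb n w (\<lambda>i. clamp01 (c i)) \<in> C i}"
        by (rule Collect_cong) (rule arg_cong[where f="\<lambda>y. y \<in> C i", OF shift])
      finally have eq: "(\<lambda>c. (c, c')) -` ?E =
          {c. (x + \<phi> (comb_seq n (\<lambda>_. 0) c')) + lincomb n w (\<lambda>i. clamp01 (c i)) \<in> C i}" .
      show "emeasure S ((\<lambda>c. (c, c')) -` ?E) = 0"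
        unfolding eq by (rule slice_null_uniform[OF C null_n])
    qed
    finally show ?thesis by simp
  qed
  define \<mu> where "\<mu> = distr S borel \<phi>"
  have "sets \<mu> = sets borel" by (simp add: \<mu>_def)
  moreover have "emeasure \<mu> (space \<mu>) = 1"
  proof -
    interpret D: prob_space \<mu> unfolding \<mu>_def by (rule P.prob_space_distr) simp
    show ?thesis by (rule D.emeasure_space_1)
  qed
  moreover have "\<exists>K. compact K \<and> emeasure \<mu> (UNIV - K) = 0"
  proof -
    let ?cube = "\<Pi>\<^sub>E i\<in>(UNIV :: nat set). {0..1::real}"
    have "compact ?cube"
      using compactin_PiE[of "\<lambda>_. euclidean" UNIV "\<lambda>_::nat. {0..1::real}"]
      by (simp add: euclidean_product_topology)
    then have "compact (\<phi> ` ?cube)"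
      by (rule compact_continuous_image[OF continuous_on_subset[OF cont subset_UNIV]])
    moreover have "emeasure \<mu> (UNIV - \<phi> ` ?cube) = 0"
    proof -
      have "\<phi> c \<in> \<phi> ` ?cube" for c
      proof
        show "\<phi> c = \<phi> (\<lambda>i. clamp01 (c i))"
          using lim[of "\<lambda>i. clamp01 (c i)"]
          by (intro LIMSEQ_unique[OF lim]) (simp add: clamp01_id clamp01_bounds)
      qed (auto simp: clamp01_bounds)
      then have empty: "\<phi> -` (UNIV - \<phi> ` ?cube) = {}" by blast
      have "UNIV - \<phi> ` ?cube \<in> sets borel"
        by (intro borel_open open_Diff open_UNIV compact_imp_closed \<open>compact (\<phi> ` ?cube)\<close>)
      then have "emeasure \<mu> (UNIV - \<phi> ` ?cube) = emeasure S (\<phi> -` (UNIV - \<phi> ` ?cube) \<inter> space S)"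
        unfolding \<mu>_def by (rule emeasure_distr[OF \<phi>_meas])
      then show ?thesis by (simp only: empty Int_empty_left emeasure_empty)
    qed
    ultimately show ?thesis by blast
  qed
  moreover have "\<exists>N \<in> null_sets \<mu>. (\<lambda>a. a + f) ` A \<subseteq> N" for f
  proof
    have "{y. y - f \<in> C i} \<in> null_sets \<mu>" for i
    proof -
      have "closed ((\<lambda>y. y - f) -` C i)"
        by (rule closed_vimage[OF C]) (intro continuous_on_diff continuous_on_const continuous_on_id)
      then have borel: "{y. y - f \<in> C i} \<in> sets borel" by (simp add: vimage_def)
      have "emeasure \<mu> {y. y - f \<in> C i} = emeasure S (\<phi> -` {y. y - f \<in> C i} \<inter> space S)"
        unfolding \<mu>_def by (rule emeasure_distr[OF \<phi>_meas borel])
      also have "\<phi> -` {y. y - f \<in> C i} \<inter> space S = {c. (-f) + \<phi> c \<in> C i}"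
        by (auto simp: space_S)
      finally show ?thesis using borel key[of "-f" i] by (auto simp: \<mu>_def null_sets_def)
    qed
    then show "(\<Union>i. {y. y - f \<in> C i}) \<in> null_sets \<mu>" by blast
    show "(\<lambda>a. a + f) ` A \<subseteq> (\<Union>i. {y. y - f \<in> C i})"
    proof (rule image_subsetI)
      fix a assume "a \<in> A"
      then obtain i where "a \<in> C i" using cover by blast
      then show "a + f \<in> (\<Union>i. {y. y - f \<in> C i})" by (intro UN_I[of i]) simp_all
    qed
  qed
  ultimately show ?thesis unfolding haar_null_def by blast
qed

section \<open>The open mapping theorem for complete subspaces\<close>

lemma complete_Baire:
  fixes S :: "'a::metric_space set" and T :: "nat \<Rightarrow> 'a set"
  assumes S: "complete S" "S \<noteq> {}" and T: "\<And>n. closed (T n)" and cover: "S \<subseteq> (\<Union>n. T n)"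
  obtains n y r where "y \<in> S" "r > 0" "ball y r \<inter> S \<subseteq> T n"
proof -
  interpret Submetric UNIV dist S by (simp add: Submetric_def Submetric_axioms_def Met_TC.Metric_space_axioms)
  have top: "sub.mtopology = top_of_set S"
    by (simp add: mtopology_submetric)
  have "sub.mcomplete"
    unfolding sub.mcomplete_def
  proof (intro allI impI)
    fix \<sigma> assume "sub.MCauchy \<sigma>"
    then have "range \<sigma> \<subseteq> S" "Cauchy \<sigma>" by (auto simp: sub.MCauchy_def Cauchy_def)
    then obtain l where "l \<in> S" "\<sigma> \<longlonglongrightarrow> l" using S(1) unfolding complete_def by (metis range_subsetD)
    then have "limitin sub.mtopology \<sigma> l sequentially"
      using \<open>range \<sigma> \<subseteq> S\<close> by (auto simp: top limitin_subtopology intro!: always_eventually)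
    then show "\<exists>x. limitin sub.mtopology \<sigma> x sequentially" ..
  qed
  then have "completely_metrizable_space (top_of_set S)"
    using sub.completely_metrizable_space_mtopology by (simp add: top)
  then have *: "(top_of_set S) interior_of \<Union>(range (\<lambda>n. S \<inter> T n)) = {}"
    if "\<And>n. (top_of_set S) interior_of (S \<inter> T n) = {}"
    using that T by (intro Baire_category_alt) (auto simp: closedin_closed_Int)
  moreover have "(top_of_set S) interior_of \<Union>(range (\<lambda>n. S \<inter> T n)) \<noteq> {}"
  proof -
    have "\<Union>(range (\<lambda>n. S \<inter> T n)) = topspace (top_of_set S)" using cover by auto
    then show ?thesis using S(2) by (simp only: interior_of_topspace) simp
  qed
  ultimately obtain n where "(top_of_set S) interior_of (S \<inter> T n) \<noteq> {}" by blast
  then obtain y U where U: "openin (top_of_set S) U" "y \<in> U" "U \<subseteq> S \<inter> T n"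
    by (auto simp: interior_of_def)
  then obtain V where V: "open V" "U = S \<inter> V" by (auto simp: openin_open)
  with U obtain r where "r > 0" "ball y r \<subseteq> V" by (meson IntD2 openE)
  with U V that[of y r n] show thesis by blast
qed

definition surjective_linear_on ::
  "'c::real_normed_vector set \<Rightarrow> 'b::real_normed_vector set \<Rightarrow> ('c \<Rightarrow> 'b) \<Rightarrow> bool" where
  "surjective_linear_on S1 S Q \<longleftrightarrow> banach_subspace S1 \<and> banach_subspace S \<and>
     linear_map_on S1 S Q \<and> continuous_on S1 Q \<and> Q ` S1 = S"

lemma linear_map_on_simps:
  assumes "linear_map_on S1 S Q" "subspace S1"
  shows "x \<in> S1 \<Longrightarrow> y \<in> S1 \<Longrightarrow> Q (x + y) = Q x + Q y"
    and "x \<in> S1 \<Longrightarrow> Q (c *\<^sub>R x) = c *\<^sub>R Q x"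
    and "x \<in> S1 \<Longrightarrow> y \<in> S1 \<Longrightarrow> Q (x - y) = Q x - Q y"
    and "Q 0 = 0"
    and "(\<And>i. i < n \<Longrightarrow> v i \<in> S1) \<Longrightarrow> Q (lincomb n v g) = lincomb n (\<lambda>i. Q (v i)) g"
proof -
  show add: "x \<in> S1 \<Longrightarrow> y \<in> S1 \<Longrightarrow> Q (x + y) = Q x + Q y" for x y
    using assms(1) by (auto simp: linear_map_on_def)
  show scale: "x \<in> S1 \<Longrightarrow> Q (c *\<^sub>R x) = c *\<^sub>R Q x" for x c
    using assms(1) by (auto simp: linear_map_on_def)
  show "x \<in> S1 \<Longrightarrow> y \<in> S1 \<Longrightarrow> Q (x - y) = Q x - Q y"
    using add[of x "(-1) *\<^sub>R y"] scale[of y "-1"] subspace_scale[OF assms(2), of y "-1"] by simp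
  show zero: "Q 0 = 0" using scale[OF subspace_0[OF assms(2)], of 0] by simp
  show "(\<And>i. i < n \<Longrightarrow> v i \<in> S1) \<Longrightarrow> Q (lincomb n v g) = lincomb n (\<lambda>i. Q (v i)) g"
  proof (induction n)
    case 0
    then show ?case by (simp add: lincomb_def zero)
  next
    case (Suc n)
    have "lincomb n v g \<in> S1" unfolding lincomb_def
      using Suc.prems by (intro subspace_sum assms(2) subspace_scale) auto
    with Suc show ?case
      by (simp add: lincomb_def add scale subspace_scale[OF assms(2)])
  qed
qed

text \<open>
  The closures of the images of the balls of integer radius cover \<open>S\<close>, so by Baire one of them contains a ball of \<open>S\<close>
  around some \<open>y0\<close>. Subtracting approximate preimages of \<open>y0\<close> moves the ball to the origin, and scaling gives the bound.
\<close>
lemma approximate_open_mapping: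
  assumes Q: "surjective_linear_on S1 S Q"
  obtains c where "c > 0"
    "\<And>y e. y \<in> S \<Longrightarrow> e > 0 \<Longrightarrow> \<exists>x\<in>S1. norm x \<le> c * norm y \<and> norm (y - Q x) < e"
proof -
  have S1: "subspace S1" and S: "subspace S" "complete S" and lin: "linear_map_on S1 S Q" and onto: "Q ` S1 = S"
    using Q by (auto simp: surjective_linear_on_def banach_subspace_def)
  note Qs = linear_map_on_simps[OF lin S1]
  define T where "T n = closure (Q ` (S1 \<inter> cball 0 (real n)))" for n
  have cover: "S \<subseteq> (\<Union>n. T n)"
  proof
    fix y assume "y \<in> S"
    then obtain x where x: "x \<in> S1" "y = Q x" using onto by blast
    obtain n :: nat where "norm x \<le> n" using real_arch_simple by blast
    with x have "y \<in> Q ` (S1 \<inter> cball 0 (real n))" by auto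
    then have "y \<in> T n" unfolding T_def by (rule subsetD[OF closure_subset])
    then show "y \<in> (\<Union>n. T n)" by blast
  qed
  obtain n y0 r where y0: "y0 \<in> S" "r > 0" "ball y0 r \<inter> S \<subseteq> T n"
  proof (rule complete_Baire[OF S(2) _ _ cover])
    show "S \<noteq> {}" using subspace_0[OF S(1)] by blast
    show "closed (T n)" for n by (simp add: T_def)
  qed
  have local: "\<exists>x\<in>S1. norm x \<le> 2 * n \<and> norm (y - Q x) < e"
    if y: "y \<in> S" "norm y < r" and e: "e > 0" for y e
  proof -
    have near: "\<exists>a\<in>S1. norm a \<le> n \<and> norm (Q a - z) < e / 2" if "z \<in> T n" for z
    proof -
      have "e / 2 > 0" using e by simp
      then obtain q where "q \<in> Q ` (S1 \<inter> cball 0 (real n))" "dist q z < e / 2"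
        using \<open>z \<in> T n\<close> unfolding T_def closure_approachable by blast
      then show ?thesis by (auto simp: dist_norm)
    qed
    have "y0 + y \<in> ball y0 r \<inter> S" "y0 \<in> ball y0 r \<inter> S"
      using y0(1,2) y subspace_add[OF S(1) y0(1) y(1)] by (simp_all add: dist_norm)
    then have "y0 + y \<in> T n" "y0 \<in> T n" using y0(3) by blast+
    then obtain a b where a: "a \<in> S1" "norm a \<le> n" "norm (Q a - (y0 + y)) < e / 2"
      and b: "b \<in> S1" "norm b \<le> n" "norm (Q b - y0) < e / 2"
      using near by meson
    have eq: "y - Q (a - b) = (Q b - y0) - (Q a - (y0 + y))"
      using a(1) b(1) by (simp add: Qs)
    have "norm (y - Q (a - b)) < e"
      unfolding eq using norm_triangle_ineq4[of "Q b - y0" "Q a - (y0 + y)"] a(3) b(3) by linarith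
    moreover have "norm (a - b) \<le> 2 * n" using norm_triangle_ineq4[of a b] a(2) b(2) by simp
    ultimately show ?thesis using subspace_diff[OF S1 a(1) b(1)] by blast
  qed
  show thesis
  proof (rule that[of "4 * n / r + 1"])
    show "0 < 4 * n / r + 1" using y0(2) by (simp add: add_nonneg_pos)
    fix y and e :: real assume y: "y \<in> S" and e: "e > 0"
    show "\<exists>x\<in>S1. norm x \<le> (4 * n / r + 1) * norm y \<and> norm (y - Q x) < e"
    proof (cases "y = 0")
      case True
      then show ?thesis using e subspace_0[OF S1] Qs(4) by (intro bexI[of _ 0]) auto
    next
      case False
      define s where "s = r / (2 * norm y)"
      have s: "s > 0" using False y0(2) by (simp add: s_def)
      have "norm (s *\<^sub>R y) < r" using False y0(2) by (simp add: s_def)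
      then obtain x where x: "x \<in> S1" "norm x \<le> 2 * n" "norm (s *\<^sub>R y - Q x) < e * s"
        using local[of "s *\<^sub>R y" "e * s"] subspace_scale[OF S(1) y] e s by auto
      have eq: "y - Q ((1 / s) *\<^sub>R x) = (1 / s) *\<^sub>R (s *\<^sub>R y - Q x)"
        using x(1) s by (simp add: Qs scaleR_diff_right)
      have "norm (y - Q ((1 / s) *\<^sub>R x)) < e"
        unfolding eq using x(3) s by (simp add: pos_divide_less_eq)
      moreover have "norm ((1 / s) *\<^sub>R x) \<le> (4 * n / r + 1) * norm y"
      proof -
        have "norm ((1 / s) *\<^sub>R x) \<le> 2 * n / s" using x(2) s by (simp add: field_simps)
        also have "\<dots> = 4 * n / r * norm y" using False y0(2) by (simp add: s_def)
        also have "\<dots> \<le> (4 * n / r + 1) * norm y" by (simp add: distrib_right)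
        finally show ?thesis .
      qed
      ultimately show ?thesis using subspace_scale[OF S1 x(1)] by blast
    qed
  qed
qed

text \<open>
  The error of an approximate preimage is at most half of the given vector and can itself be approximated.
  Iterating this yields a series whose terms decay geometrically and whose sum is an exact preimage.
\<close>
lemma open_mapping_on:
  assumes Q: "surjective_linear_on S1 S Q"
  obtains M where "M > 0" "\<And>y. y \<in> S \<Longrightarrow> \<exists>x\<in>S1. Q x = y \<and> norm x \<le> M * norm y"
proof -
  have S1: "subspace S1" "complete S1" and S: "subspace S" and lin: "linear_map_on S1 S Q"
    and cont: "continuous_on S1 Q" and onto: "Q ` S1 = S"
    using Q by (auto simp: surjective_linear_on_def banach_subspace_def)
  note Qs = linear_map_on_simps[OF lin S1(1)]
  obtain c where c: "c > 0"
    and approx: "\<And>y e. y \<in> S \<Longrightarrow> e > 0 \<Longrightarrow> \<exists>x\<in>S1. norm x \<le> c * norm y \<and> norm (y - Q x) < e"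
    using approximate_open_mapping[OF Q] by blast
  have "\<exists>x\<in>S1. norm x \<le> c * norm y \<and> norm (y - Q x) \<le> norm y / 2" if "y \<in> S" for y
  proof (cases "y = 0")
    case True
    then show ?thesis using subspace_0[OF S1(1)] Qs(4) by (intro bexI[of _ 0]) auto
  next
    case False
    then have "norm y / 2 > 0" by simp
    from approx[OF that this] show ?thesis using less_imp_le by blast
  qed
  then obtain g where g: "\<And>y. y \<in> S \<Longrightarrow> g y \<in> S1 \<and> norm (g y) \<le> c * norm y \<and> norm (y - Q (g y)) \<le> norm y / 2"
    by metis
  have lift: "\<exists>x\<in>S1. Q x = y \<and> norm x \<le> 2 * c * norm y" if y: "y \<in> S" for y
  proof -
    define Y where "Y n = ((\<lambda>z. z - Q (g z)) ^^ n) y" for n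
    have Y_Suc: "Y (Suc n) = Y n - Q (g (Y n))" for n by (simp add: Y_def)
    have YS: "Y n \<in> S" for n
    proof (induction n)
      case 0
      then show ?case using y by (simp add: Y_def)
    next
      case (Suc n)
      then have "Q (g (Y n)) \<in> S" using g onto by blast
      with Suc show ?case unfolding Y_Suc by (rule subspace_diff[OF S])
    qed
    have Y_bound: "norm (Y n) \<le> norm y * (1/2) ^ n" for n
    proof (induction n)
      case 0
      then show ?case by (simp add: Y_def)
    next
      case (Suc n)
      then show ?case using g[OF YS[of n]] unfolding Y_Suc by simp
    qed
    define X where "X n = (\<Sum>i<n. g (Y i))" for n
    have XS: "X n \<in> S1" for n unfolding X_def using g[OF YS] by (intro subspace_sum S1(1)) auto
    have QX: "Q (X n) = y - Y n" for n
    proof (induction n)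
      case 0
      then show ?case by (simp add: X_def Y_def Qs)
    next
      case (Suc n)
      have "X (Suc n) = X n + g (Y n)" by (simp add: X_def)
      then have "Q (X (Suc n)) = Q (X n) + Q (g (Y n))" using XS g[OF YS[of n]] by (simp add: Qs)
      then show ?case using Suc by (simp add: Y_Suc)
    qed
    have diff: "norm (X m - X n) \<le> 2 * c * norm y * (1/2) ^ n - 2 * c * norm y * (1/2) ^ m" if "n \<le> m" for n m
      using that
    proof (induction m rule: dec_induct)
      case base
      then show ?case by simp
    next
      case (step m)
      have "norm (X (Suc m) - X m) \<le> c * (norm y * (1/2) ^ m)"
        using g[OF YS[of m]] mult_left_mono[OF Y_bound[of m] less_imp_le[OF c]] by (simp add: X_def)
      then show ?case
        using step.IH norm_triangle_ineq[of "X (Suc m) - X m" "X m - X n"] by simp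
    qed
    have lim0: "(\<lambda>n. K * (1/2) ^ n) \<longlonglongrightarrow> 0" for K :: real
      using tendsto_mult[OF tendsto_const[of K] LIMSEQ_power_zero[of "1/2::real"]] by simp
    have "Cauchy X"
    proof (rule metric_CauchyI)
      fix e :: real assume "e > 0"
      then have "eventually (\<lambda>n. 2 * c * norm y * (1/2) ^ n < e / 2) sequentially"
        by (intro order_tendstoD(2)[OF lim0]) simp
      then obtain N where N: "2 * c * norm y * (1/2) ^ N < e / 2" by (auto simp: eventually_sequentially)
      have near: "dist (X m) (X N) < e / 2" if "N \<le> m" for m
      proof -
        have "0 \<le> 2 * c * norm y * (1/2) ^ m" using c by simp
        with diff[OF that] N show ?thesis by (simp add: dist_norm)
      qed
      have "dist (X m) (X n) < e" if "N \<le> m" "N \<le> n" for m n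
        by (rule dist_triangle_half_l[OF near[OF that(1)] near[OF that(2)]])
      then show "\<exists>M. \<forall>m\<ge>M. \<forall>n\<ge>M. dist (X m) (X n) < e" by blast
    qed
    then obtain x where x: "x \<in> S1" "X \<longlonglongrightarrow> x" using S1(2) XS unfolding complete_def by metis
    have "(\<lambda>n. Q (X n)) \<longlonglongrightarrow> Q x"
      by (rule continuous_on_tendsto_compose[OF cont x(2) x(1)]) (simp add: XS)
    moreover have "(\<lambda>n. Q (X n)) \<longlonglongrightarrow> y - 0"
      unfolding QX
      by (intro tendsto_diff tendsto_const Lim_null_comparison[OF _ lim0[of "norm y"]]) (simp add: Y_bound)
    ultimately have "Q x = y" using LIMSEQ_unique by fastforce
    moreover have "norm x \<le> 2 * c * norm y"
    proof (rule LIMSEQ_le_const2[OF tendsto_norm[OF x(2)]])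
      have "norm (X n) \<le> 2 * c * norm y" for n
      proof -
        have "0 \<le> 2 * c * norm y * (1/2) ^ n" using c by simp
        moreover have "X 0 = 0" by (simp add: X_def)
        ultimately show ?thesis using diff[of 0 n] by simp
      qed
      then show "\<exists>N. \<forall>n\<ge>N. norm (X n) \<le> 2 * c * norm y" by blast
    qed
    ultimately show ?thesis using x(1) by blast
  qed
  show thesis by (rule that[of "2 * c"]) (use c lift in auto)
qed

section \<open>Lipschitz graphs and transversality\<close>

lemma lincomb_diff: "lincomb p v (\<lambda>i. a i - b i) = lincomb p v a - lincomb p v b"
  by (simp add: lincomb_def scaleR_diff_left sum_subtractf)

lemma lincomb_scale: "lincomb p v (\<lambda>i. r * a i) = r *\<^sub>R lincomb p v a"
  by (simp add: lincomb_def scaleR_sum_right)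

lemma lincomb_diff_family: "lincomb p (\<lambda>i. v i - w i) a = lincomb p v a - lincomb p w a"
  by (simp add: lincomb_def scaleR_diff_right sum_subtractf)

lemma lincomb_in_subspace:
  "subspace S \<Longrightarrow> (\<And>i. i < p \<Longrightarrow> v i \<in> S) \<Longrightarrow> lincomb p v a \<in> S"
  unfolding lincomb_def by (intro subspace_sum subspace_scale) auto

lemma continuous_on_lincomb_normed:
  fixes v :: "nat \<Rightarrow> 'b::real_normed_vector"
  shows "continuous_on S (lincomb p v)"
  unfolding lincomb_def[abs_def]
  by (rule continuous_on_sum) (rule continuous_on_scaleR[OF continuous_on_coord continuous_on_const])

lemma norm_lincomb_le:
  assumes "\<And>i. i < p \<Longrightarrow> norm (v i) \<le> K"
  shows "norm (lincomb p v a) \<le> K * (\<Sum>i<p. \<bar>a i\<bar>)"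
proof -
  have "norm (lincomb p v a) \<le> (\<Sum>i<p. norm (a i *\<^sub>R v i))"
    unfolding lincomb_def by (rule norm_sum)
  also have "\<dots> \<le> (\<Sum>i<p. K * \<bar>a i\<bar>)"
    using assms by (intro sum_mono) (simp add: mult.commute[of K] mult_left_mono)
  finally show ?thesis by (simp add: sum_distrib_left)
qed

lemma compact_cube: "compact (\<Pi>\<^sub>E i\<in>(UNIV :: nat set). {-R i..R i :: real})"
  using compactin_PiE[of "\<lambda>_. euclidean" UNIV "\<lambda>i. {-R i..R i :: real}"]
  by (simp add: euclidean_product_topology)

text \<open>
  On the compact set of coordinates with \<open>\<Sum> |a\<^sub>i| = 1\<close> the distance of \<open>\<Sum> a\<^sub>i t\<^sub>i\<close> to \<open>D\<close> attains its minimum, which is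
  positive; homogeneity does the rest. The case \<open>D = {0}\<close> is the equivalence of norms on the span of the \<open>t\<^sub>i\<close>, and
  the general case is the continuity of the projection along \<open>D\<close>.
\<close>
lemma coordinates_bounded:
  fixes t :: "nat \<Rightarrow> 'c::real_normed_vector"
  assumes D: "subspace D" "closed D"
    and indep: "\<And>a i. lincomb p t a \<in> D \<Longrightarrow> i < p \<Longrightarrow> a i = 0"
  obtains m where "m > 0" "\<And>x a. x \<in> D \<Longrightarrow> m * (\<Sum>i<p. \<bar>a i\<bar>) \<le> norm (x + lincomb p t a)"
proof (cases "p = 0")
  case True
  then show thesis by (intro that[of 1]) auto
next
  case False
  define R where "R i = (if i < p then 1 else 0 :: real)" for i
  define K where "K = (\<Pi>\<^sub>E i\<in>UNIV. {-R i..R i}) \<inter> (\<lambda>a. \<Sum>i<p. \<bar>a i\<bar>) -` {1}"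
  have "closed ((\<lambda>a::nat\<Rightarrow>real. \<Sum>i<p. \<bar>a i\<bar>) -` {1})"
    by (rule closed_vimage[OF closed_singleton])
       (rule continuous_on_sum, rule continuous_on_rabs, rule continuous_on_coord)
  then have K: "compact K" unfolding K_def by (rule compact_Int_closed[OF compact_cube])
  let ?h = "\<lambda>a. infdist (lincomb p t a) D"
  have h: "continuous_on K ?h"
    by (rule continuous_on_infdist) (rule continuous_on_lincomb_normed)
  have "(\<lambda>i. if i = 0 then 1 else 0) \<in> K"
    using False by (auto simp: K_def R_def if_distrib[of abs] cong: if_cong)
  then obtain a0 where a0: "a0 \<in> K" "\<And>a. a \<in> K \<Longrightarrow> ?h a0 \<le> ?h a"
    using continuous_attains_inf[OF K _ h] by blast
  have D_ne: "D \<noteq> {}" using subspace_0[OF D(1)] by blast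
  have "?h a0 \<noteq> 0"
  proof
    assume "?h a0 = 0"
    then have "lincomb p t a0 \<in> D" using in_closed_iff_infdist_zero[OF D(2) D_ne] by blast
    then have "a0 i = 0" if "i < p" for i using that by (rule indep)
    then have "(\<Sum>i<p. \<bar>a0 i\<bar>) = 0" by simp
    with a0(1) show False by (simp add: K_def)
  qed
  then have pos: "?h a0 > 0" using infdist_nonneg[of "lincomb p t a0" D] by linarith
  show thesis
  proof (rule that[OF pos])
    fix x and a :: "nat \<Rightarrow> real" assume x: "x \<in> D"
    define s where "s = (\<Sum>i<p. \<bar>a i\<bar>)"
    show "?h a0 * (\<Sum>i<p. \<bar>a i\<bar>) \<le> norm (x + lincomb p t a)"
    proof (cases "s = 0")
      case True
      then show ?thesis by (simp add: s_def)
    next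
      case False
      moreover have "s \<ge> 0" unfolding s_def by (intro sum_nonneg) simp
      ultimately have s: "s > 0" by linarith
      define b where "b i = (if i < p then (1 / s) * a i else 0)" for i
      have b_sum: "(\<Sum>i<p. \<bar>b i\<bar>) = 1"
        using s by (simp add: b_def abs_mult s_def sum_divide_distrib[symmetric])
      have "\<bar>b i\<bar> \<le> R i" for i
      proof (cases "i < p")
        case True
        then have "\<bar>b i\<bar> \<le> (\<Sum>i<p. \<bar>b i\<bar>)" by (intro member_le_sum) auto
        with b_sum True show ?thesis by (simp add: R_def)
      qed (simp add: b_def R_def)
      then have "b \<in> K" using b_sum by (auto simp: K_def abs_le_iff minus_le_iff)
      then have "?h a0 \<le> infdist (lincomb p t b) D" by (rule a0(2))
      also have "\<dots> \<le> dist (lincomb p t b) ((- 1 / s) *\<^sub>R x)"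
        by (rule infdist_le) (rule subspace_scale[OF D(1) x])
      also have "lincomb p t b = (1 / s) *\<^sub>R lincomb p t a"
        unfolding lincomb_scale[symmetric] by (simp add: lincomb_def b_def)
      also have "dist ((1 / s) *\<^sub>R lincomb p t a) ((- 1 / s) *\<^sub>R x) = norm ((1 / s) *\<^sub>R (x + lincomb p t a))"
        by (simp add: dist_norm scaleR_add_right add.commute)
      also have "\<dots> = norm (x + lincomb p t a) / s" using s by simp
      finally show ?thesis using s by (simp add: s_def[symmetric] pos_le_divide_eq)
    qed
  qed
qed

text \<open>
  An indexed form of a basis. The index set \<open>{..<p}\<close> is the one of the coordinate spaces \<^term>\<open>lborel_pow p\<close>.
\<close>
definition basis_family :: "nat \<Rightarrow> (nat \<Rightarrow> 'b::real_vector) \<Rightarrow> 'b set \<Rightarrow> bool" where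
  "basis_family p t T \<longleftrightarrow> (\<forall>i<p. t i \<in> T) \<and> (\<forall>x\<in>T. \<exists>a. x = lincomb p t a) \<and>
     (\<forall>a. lincomb p t a = 0 \<longrightarrow> (\<forall>i<p. a i = 0))"

lemma has_finite_dim_basis_family:
  assumes "has_finite_dim T p"
  obtains t where "basis_family p t T"
proof -
  from assms obtain B where B: "finite B" "independent B" "span B = T" "card B = p"
    by (auto simp: has_finite_dim_def)
  obtain t where t: "bij_betw t {..<p} B"
    using ex_bij_betw_nat_finite[OF B(1)] B(4) by (auto simp: atLeast0LessThan)
  have sum_eq: "(\<Sum>v\<in>B. u v *\<^sub>R v) = lincomb p t (\<lambda>i. u (t i))" for u
    unfolding lincomb_def by (rule sum.reindex_bij_betw[OF t, symmetric])
  have "t i \<in> T" if "i < p" for i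
    using that t B(3) by (auto simp: bij_betw_def intro: span_base)
  moreover have "\<exists>a. x = lincomb p t a" if "x \<in> T" for x
    using that B(1,3) span_finite[OF B(1)] sum_eq by auto
  moreover have "a i = 0" if "lincomb p t a = 0" "i < p" for a i
  proof -
    define u where "u v = a (the_inv_into {..<p} t v)" for v
    have u: "u (t i) = a i" if "i < p" for i
      using that t by (simp add: u_def bij_betw_def the_inv_into_f_f)
    have "(\<Sum>v\<in>B. u v *\<^sub>R v) = lincomb p t a"
      unfolding sum_eq by (simp add: lincomb_def u)
    then have "(\<Sum>v\<in>B. u v *\<^sub>R v) = 0" using that(1) by simp
    moreover have "t i \<in> B" using that(2) t by (auto simp: bij_betw_def)
    ultimately have "u (t i) = 0" using independentD[OF B(2,1) subset_refl] by blast
    with u[OF that(2)] show ?thesis by simp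
  qed
  ultimately have "basis_family p t T" by (auto simp: basis_family_def)
  then show thesis by (rule that)
qed

text \<open>
  The cone condition on differences of points of \<open>A\<close>, with the norm on the span of \<open>t\<close> measured in coordinates. It is stated
  without the projection to the span, because in this form it is a closed condition on the two points.
\<close>
definition transversal :: "real \<Rightarrow> nat \<Rightarrow> (nat \<Rightarrow> 'c::real_normed_vector) \<Rightarrow> 'c set \<Rightarrow> bool" where
  "transversal K p t A \<longleftrightarrow>
     (\<forall>x\<in>A. \<forall>y\<in>A. \<forall>a. (\<Sum>i<p. \<bar>a i\<bar>) \<le> K * norm (x - y - lincomb p t a))"

text \<open>
  For two points of the graph write \<open>x - y = \<xi> + \<tau>\<close> with \<open>\<xi> \<in> D\<close> and \<open>|\<tau>| \<le> L |\<xi>|\<close>. If \<open>z = x - y - \<Sum> a\<^sub>i t\<^sub>i\<close>, the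
  component of \<open>z\<close> in \<open>D\<close> is \<open>\<xi>\<close>, so \<open>\<xi>\<close>, and hence \<open>\<tau>\<close>, is controlled by \<open>z\<close>; the component of \<open>z\<close> in \<open>T\<close>, which is
  \<open>\<tau> - \<Sum> a\<^sub>i t\<^sub>i\<close>, is controlled by \<open>z\<close> as well.
\<close>
lemma lipschitz_graph_transversal:
  assumes "lipschitz_graph S p A"
  obtains t K where "K > 0" "\<And>i. i < p \<Longrightarrow> t i \<in> S" "A \<subseteq> S" "transversal K p t A"
proof -
  from assms obtain D T D1 g L where sum: "direct_sum S D T" and D: "closed D"
    and T: "has_finite_dim T p" and g: "D1 \<subseteq> D" "g ` D1 \<subseteq> T" and L: "L-lipschitz_on D1 g"
    and A: "A = {x + g x | x. x \<in> D1}"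
    unfolding lipschitz_graph_def by blast
  obtain t where t: "basis_family p t T" using has_finite_dim_basis_family[OF T] .
  have sub: "subspace D" "subspace T" "D \<inter> T = {0}" "S = {x + y | x y. x \<in> D \<and> y \<in> T}"
    using sum by (auto simp: direct_sum_def)
  have lin_T: "lincomb p t a \<in> T" for a
    using t by (intro lincomb_in_subspace sub(2)) (auto simp: basis_family_def)
  have "a i = 0" if "lincomb p t a \<in> D" "i < p" for a i
    using that lin_T[of a] sub(3) t unfolding basis_family_def by blast
  then obtain m where m: "m > 0" "\<And>x a. x \<in> D \<Longrightarrow> m * (\<Sum>i<p. \<bar>a i\<bar>) \<le> norm (x + lincomb p t a)"
    using coordinates_bounded[OF sub(1) D] by blast
  have L0: "L \<ge> 0" using L by (rule lipschitz_on_nonneg)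
  define B where "B = (\<Sum>i<p. norm (t i))"
  have B: "norm (lincomb p t a) \<le> B * (\<Sum>i<p. \<bar>a i\<bar>)" for a
    unfolding B_def by (rule norm_lincomb_le) (auto intro: member_le_sum)
  have B0: "B \<ge> 0" by (simp add: B_def sum_nonneg)
  define K where "K = (L * (1 + B / m) + 1) / m"
  have K: "K > 0" using m(1) L0 B0 by (simp add: K_def add_nonneg_pos)
  have "(\<Sum>i<p. \<bar>a i\<bar>) \<le> K * norm (x - y - lincomb p t a)" if xy: "x \<in> A" "y \<in> A" for x y a
  proof -
    obtain x1 y1 where x1: "x1 \<in> D1" "x = x1 + g x1" and y1: "y1 \<in> D1" "y = y1 + g y1"
      using xy A by blast
    define \<xi> where "\<xi> = x1 - y1"
    have \<xi>: "\<xi> \<in> D" using x1 y1 g(1) by (auto simp: \<xi>_def intro: subspace_diff[OF sub(1)])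
    have "g x1 - g y1 \<in> T" using x1 y1 g(2) by (auto intro: subspace_diff[OF sub(2)])
    then obtain \<tau> where \<tau>: "g x1 - g y1 = lincomb p t \<tau>" using t by (auto simp: basis_family_def)
    define z where "z = x - y - lincomb p t a"
    define \<sigma> where "\<sigma> = (\<Sum>i<p. \<bar>\<tau> i - a i\<bar>)"
    have z: "z = \<xi> + lincomb p t (\<lambda>i. \<tau> i - a i)"
      by (simp add: z_def \<xi>_def lincomb_diff \<tau>[symmetric] x1 y1)
    have s1: "m * \<sigma> \<le> norm z" unfolding z \<sigma>_def by (rule m(2)[OF \<xi>])
    have "norm \<xi> \<le> norm z + norm (lincomb p t (\<lambda>i. \<tau> i - a i))"
      using norm_triangle_ineq4[of z "lincomb p t (\<lambda>i. \<tau> i - a i)"] by (simp add: z)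
    also have "\<dots> \<le> norm z + B * \<sigma>" using B by (simp add: \<sigma>_def)
    also have "\<dots> \<le> norm z + B * (norm z / m)"
      using s1 m(1) B0 by (intro add_left_mono mult_left_mono) (simp_all add: pos_le_divide_eq mult.commute)
    finally have s2: "norm \<xi> \<le> (1 + B / m) * norm z" by (simp add: algebra_simps)
    have "m * (\<Sum>i<p. \<bar>\<tau> i\<bar>) \<le> norm (g x1 - g y1)"
      using m(2)[OF subspace_0[OF sub(1)], of \<tau>] by (simp add: \<tau>)
    also have "\<dots> \<le> L * norm \<xi>"
      using lipschitz_onD[OF L x1(1) y1(1)] by (simp add: dist_norm \<xi>_def)
    also have "\<dots> \<le> L * ((1 + B / m) * norm z)" using s2 L0 by (rule mult_left_mono)
    finally have s3: "m * (\<Sum>i<p. \<bar>\<tau> i\<bar>) \<le> L * ((1 + B / m) * norm z)" .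
    have "(\<Sum>i<p. \<bar>a i\<bar>) \<le> (\<Sum>i<p. \<bar>\<tau> i\<bar> + \<bar>\<tau> i - a i\<bar>)" by (intro sum_mono) auto
    also have "\<dots> = (\<Sum>i<p. \<bar>\<tau> i\<bar>) + \<sigma>" by (simp add: sum.distrib \<sigma>_def)
    finally have "m * (\<Sum>i<p. \<bar>a i\<bar>) \<le> m * (\<Sum>i<p. \<bar>\<tau> i\<bar>) + m * \<sigma>"
      using mult_left_mono[of _ _ m] m(1) by (fastforce simp: distrib_left)
    also have "\<dots> \<le> L * ((1 + B / m) * norm z) + norm z" using s1 s3 by linarith
    also have "\<dots> = m * (K * norm z)" using m(1) by (simp add: K_def field_simps)
    finally show ?thesis using m(1) by (simp add: z_def)
  qed
  then have "transversal K p t A" by (simp add: transversal_def)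
  moreover have "A \<subseteq> S" unfolding A sub(4) using g by blast
  moreover have "t i \<in> S" if "i < p" for i
  proof -
    have "t i = 0 + t i" "t i \<in> T" using t that by (auto simp: basis_family_def)
    then show ?thesis unfolding sub(4) using subspace_0[OF sub(1)] by blast
  qed
  ultimately show thesis using that K by blast
qed

lemma transversal_closure:
  assumes "transversal K p t A"
  shows "transversal K p t (closure A)"
  unfolding transversal_def
proof (intro ballI allI)
  fix x y a assume "x \<in> closure A" "y \<in> closure A"
  then obtain X Y where X: "\<And>n. X n \<in> A" "X \<longlonglongrightarrow> x" and Y: "\<And>n. Y n \<in> A" "Y \<longlonglongrightarrow> y"
    unfolding closure_sequential by metis
  have "(\<lambda>n. K * norm (X n - Y n - lincomb p t a)) \<longlonglongrightarrow> K * norm (x - y - lincomb p t a)"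
    by (intro tendsto_intros X Y)
  then show "(\<Sum>i<p. \<bar>a i\<bar>) \<le> K * norm (x - y - lincomb p t a)"
    by (rule LIMSEQ_le_const) (use assms X(1) Y(1) in \<open>auto simp: transversal_def\<close>)
qed

text \<open>
  Moving each \<open>t i\<close> by at most \<open>1 / (2 K)\<close> changes the right-hand side of the cone condition by at most half of the
  left-hand side, which is absorbed.
\<close>
lemma transversal_perturb:
  assumes A: "transversal K p t A" and K: "K > 0"
    and near: "\<And>i. i < p \<Longrightarrow> norm (w i - t i) \<le> 1 / (2 * K)"
    and x: "x \<in> A" "y \<in> A" and eq: "x - y = lincomb p w a + n"
  shows "(\<Sum>i<p. \<bar>a i\<bar>) \<le> 2 * K * norm n"
proof -
  let ?s = "\<Sum>i<p. \<bar>a i\<bar>"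
  have bound: "norm (lincomb p (\<lambda>i. w i - t i) a) \<le> 1 / (2 * K) * ?s"
    using near by (rule norm_lincomb_le)
  have "?s \<le> K * norm (x - y - lincomb p t a)" using A x by (auto simp: transversal_def)
  also have "x - y - lincomb p t a = lincomb p (\<lambda>i. w i - t i) a + n"
    unfolding lincomb_diff_family by (simp add: eq)
  also have "K * norm \<dots> \<le> K * (1 / (2 * K) * ?s + norm n)"
    using K norm_triangle_ineq[of "lincomb p (\<lambda>i. w i - t i) a" n] bound
    by (intro mult_left_mono) auto
  also have "\<dots> = ?s / 2 + K * norm n" using K by (simp add: field_simps)
  finally show ?thesis by simp
qed

section \<open>Covering rectifiable sets by closed sets with null slices\<close>

lemma fredholm_onto:
  assumes "fredholm S1 S Q k 0" "banach_subspace S1" "banach_subspace S"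
  shows "surjective_linear_on S1 S Q"
proof -
  from assms(1) obtain C where C: "direct_sum S (Q ` S1) C" "has_finite_dim C 0"
    and Q: "linear_map_on S1 S Q" "continuous_on S1 Q"
    unfolding fredholm_def by blast
  from C(2) have "C = {0}" by (auto simp: has_finite_dim_def)
  with C(1) have "S = Q ` S1" by (auto simp: direct_sum_def)
  with Q assms(2,3) show ?thesis by (simp add: surjective_linear_on_def)
qed

lemma basis_coordinates_bounded:
  fixes b :: "nat \<Rightarrow> 'c::real_normed_vector"
  assumes "basis_family k b N"
  obtains m where "m > 0" "\<And>e. m * (\<Sum>j<k. \<bar>e j\<bar>) \<le> norm (lincomb k b e)"
proof -
  have "e j = 0" if "lincomb k b e \<in> {0}" "j < k" for e j
    using assms that by (auto simp: basis_family_def)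
  then obtain m where m: "m > 0"
    "\<And>x e. x \<in> {0::'c} \<Longrightarrow> m * (\<Sum>j<k. \<bar>e j\<bar>) \<le> norm (x + lincomb k b e)"
    using coordinates_bounded[OF subspace_single_0 closed_singleton, of k b] by blast
  from m(2)[OF singletonI] have "m * (\<Sum>j<k. \<bar>e j\<bar>) \<le> norm (lincomb k b e)" for e by simp
  with m(1) show thesis by (rule that)
qed

text \<open>
  Let \<open>Q a\<^sub>n \<rightarrow> y = Q z\<close>. By the open mapping theorem \<open>a\<^sub>n\<close> differs from \<open>z\<close> by a null sequence \<open>h\<^sub>n\<close> and an element of the kernel. The kernel
  elements stay bounded, and the kernel has finite dimension, so a subsequence of \<open>a\<^sub>n\<close> converges. Without the
  restriction to a ball the image of a closed set need not be closed.
\<close>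
lemma closed_image_bounded_part:
  fixes Q :: "'c::real_normed_vector \<Rightarrow> 'b::real_normed_vector"
  assumes Q: "surjective_linear_on S1 S Q" and b: "basis_family k b {x \<in> S1. Q x = 0}"
    and A: "closed A" "A \<subseteq> S1"
  shows "closed (Q ` (A \<inter> cball 0 R))"
  unfolding closed_sequential_limits
proof (intro allI impI, elim conjE)
  fix Y y assume Y: "\<forall>n. Y n \<in> Q ` (A \<inter> cball 0 R)" and lim: "Y \<longlonglongrightarrow> y"
  have S1: "subspace S1" and S: "subspace S" "complete S" and lin: "linear_map_on S1 S Q"
    and cont: "continuous_on S1 Q" and onto: "Q ` S1 = S"
    using Q by (auto simp: surjective_linear_on_def banach_subspace_def)
  note Qs = linear_map_on_simps[OF lin S1]
  obtain M where M: "M > 0" "\<And>y. y \<in> S \<Longrightarrow> \<exists>x\<in>S1. Q x = y \<and> norm x \<le> M * norm y"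
    using open_mapping_on[OF Q] by blast
  obtain m where m: "m > 0" "\<And>e. m * (\<Sum>j<k. \<bar>e j\<bar>) \<le> norm (lincomb k b e)"
    using basis_coordinates_bounded[OF b] by blast
  obtain a where a: "\<And>n. a n \<in> A" "\<And>n. norm (a n) \<le> R" "\<And>n. Y n = Q (a n)"
  proof -
    have "\<exists>a. a \<in> A \<and> norm a \<le> R \<and> Y n = Q a" for n using Y by fastforce
    then show thesis using that by metis
  qed
  have aS: "a n \<in> S1" for n using a(1) A(2) by blast
  have "Y n \<in> S" for n using a(3) aS onto by auto
  then have yS: "y \<in> S"
    using complete_imp_closed[OF S(2)] lim closed_sequentially by blast
  then obtain z where z: "z \<in> S1" "Q z = y" using onto by blast
  have "\<exists>x\<in>S1. Q x = Y n - y \<and> norm x \<le> M * norm (Y n - y)" for n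
    by (intro M(2) subspace_diff[OF S(1)] \<open>Y n \<in> S\<close> yS)
  then obtain h where h: "\<And>n. h n \<in> S1" "\<And>n. Q (h n) = Y n - y" "\<And>n. norm (h n) \<le> M * norm (Y n - y)"
    by metis
  have "(\<lambda>n. M * norm (Y n - y)) \<longlonglongrightarrow> M * norm (y - y)"
    by (intro tendsto_intros lim)
  then have h0: "h \<longlonglongrightarrow> 0"
    by (intro Lim_null_comparison[of h "\<lambda>n. M * norm (Y n - y)"]) (use h(3) in auto)
  then obtain H where H: "\<And>n. norm (h n) \<le> H"
    using convergent_imp_Bseq[of h] by (auto simp: convergent_def Bseq_def)
  have kern: "a n - z - h n \<in> {x \<in> S1. Q x = 0}" for n
    using aS z h(1,2) a(3) by (simp add: Qs subspace_diff[OF S1])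
  have "\<exists>e. a n - z - h n = lincomb k b e" for n using b kern[of n] by (auto simp: basis_family_def)
  then obtain e where e: "\<And>n. a n - z - h n = lincomb k b (e n)" by metis
  define R' where "R' = (R + norm z + H) / m"
  let ?K = "lincomb k b ` (\<Pi>\<^sub>E i\<in>UNIV. {-R'..R'})"
  have compact: "compact ?K"
    by (rule compact_continuous_image[OF continuous_on_lincomb_normed compact_cube])
  have R': "0 \<le> R'"
    using order_trans[OF norm_ge_zero a(2)[of 0]] order_trans[OF norm_ge_zero H[of 0]] m(1)
    by (simp add: R'_def)
  have "a n - z - h n \<in> ?K" for n
  proof -
    let ?e = "\<lambda>j. if j < k then e n j else 0"
    have "m * (\<Sum>j<k. \<bar>e n j\<bar>) \<le> norm (a n - z - h n)" unfolding e by (rule m(2))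
    also have "\<dots> \<le> R + norm z + H"
      using norm_triangle_ineq4[of "a n - z" "h n"] norm_triangle_ineq4[of "a n" z] a(2)[of n] H[of n]
      by linarith
    finally have sum: "(\<Sum>j<k. \<bar>e n j\<bar>) \<le> R'" using m(1) by (simp add: R'_def pos_le_divide_eq mult.commute)
    have "\<bar>?e j\<bar> \<le> R'" for j
    proof (cases "j < k")
      case True
      then have "\<bar>e n j\<bar> \<le> (\<Sum>j<k. \<bar>e n j\<bar>)" by (intro member_le_sum) auto
      with sum True show ?thesis by simp
    qed (simp add: R')
    then have "?e \<in> (\<Pi>\<^sub>E i\<in>UNIV. {-R'..R'})" by (auto simp: abs_le_iff minus_le_iff)
    moreover have "a n - z - h n = lincomb k b ?e" unfolding e by (simp add: lincomb_def)
    ultimately show ?thesis by blast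
  qed
  then obtain l r where r: "strict_mono (r :: nat \<Rightarrow> nat)"
    and l: "((\<lambda>n. a n - z - h n) \<circ> r) \<longlonglongrightarrow> l"
    using compact[unfolded compact_def, rule_format, of "\<lambda>n. a n - z - h n"] by blast
  have "(\<lambda>n. ((\<lambda>n. a n - z - h n) \<circ> r) n + z + (h \<circ> r) n) \<longlonglongrightarrow> l + z + 0"
    by (intro tendsto_add l tendsto_const LIMSEQ_subseq_LIMSEQ[OF h0 r])
  then have ar: "(a \<circ> r) \<longlonglongrightarrow> l + z" by (simp add: o_def)
  have "l + z \<in> A \<inter> cball 0 R"
    using closed_sequentially[OF closed_Int[OF A(1) closed_cball] _ ar, of 0 R] a(1,2) by auto
  moreover have "Q (l + z) = y"
  proof (rule LIMSEQ_unique)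
    have "l + z \<in> S1" using \<open>l + z \<in> A \<inter> cball 0 R\<close> A(2) by blast
    then show "(\<lambda>n. Q ((a \<circ> r) n)) \<longlonglongrightarrow> Q (l + z)"
      by (rule continuous_on_tendsto_compose[OF cont ar]) (simp add: aS)
    show "(\<lambda>n. Q ((a \<circ> r) n)) \<longlonglongrightarrow> y"
      using LIMSEQ_subseq_LIMSEQ[OF lim r] by (simp add: o_def a(3))
  qed
  ultimately show "y \<in> Q ` (A \<inter> cball 0 R)" by blast
qed

text \<open>
  \<open>Q (t i)\<close> is a limit of points \<open>P v\<close> with \<open>v \<in> Y\<close>, and by the open mapping theorem a small difference \<open>P v - Q (t i)\<close> has a
  small preimage, which corrects \<open>t i\<close>.
\<close>
lemma approximate_directions:
  fixes P :: "'f::topological_space \<Rightarrow> 'b::real_normed_vector" and t :: "nat \<Rightarrow> 'c::real_normed_vector"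
  assumes Q: "surjective_linear_on S1 S Q" and t: "\<And>i. i < p \<Longrightarrow> t i \<in> S1"
    and P: "continuous_on UNIV P" "range P \<subseteq> S" "S \<subseteq> closure (range P)"
    and Y: "closure Y = UNIV" and \<epsilon>: "\<epsilon> > 0"
  obtains v w where "\<And>i. i < p \<Longrightarrow> v i \<in> Y" "\<And>i. i < p \<Longrightarrow> w i \<in> S1"
    "\<And>i. i < p \<Longrightarrow> Q (w i) = P (v i)" "\<And>i. i < p \<Longrightarrow> norm (w i - t i) \<le> \<epsilon>"
proof -
  have S1: "subspace S1" and S: "subspace S" and lin: "linear_map_on S1 S Q" and onto: "Q ` S1 = S"
    using Q by (auto simp: surjective_linear_on_def banach_subspace_def)
  note Qs = linear_map_on_simps[OF lin S1]
  obtain M where M: "M > 0" "\<And>y. y \<in> S \<Longrightarrow> \<exists>x\<in>S1. Q x = y \<and> norm x \<le> M * norm y"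
    using open_mapping_on[OF Q] by blast
  have "P ` closure Y \<subseteq> closure (P ` Y)"
  proof (rule image_closure_subset)
    show "continuous_on (closure Y) P" unfolding Y by (rule P(1))
  qed (rule closed_closure, rule closure_subset)
  then have "closure (range P) \<subseteq> closure (P ` Y)" unfolding Y by (intro closure_minimal) auto
  with P(3) have dense: "S \<subseteq> closure (P ` Y)" by blast
  have "\<exists>v w. v \<in> Y \<and> w \<in> S1 \<and> Q w = P v \<and> norm (w - t i) \<le> \<epsilon>" if i: "i < p" for i
  proof -
    have Qt: "Q (t i) \<in> S" using t[OF i] onto by blast
    have "\<epsilon> / M > 0" using \<epsilon> M(1) by simp
    then obtain v where v: "v \<in> Y" "dist (P v) (Q (t i)) < \<epsilon> / M"
      using dense Qt unfolding closure_approachable subset_eq by blast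
    have "P v - Q (t i) \<in> S" using P(2) Qt by (intro subspace_diff[OF S]) auto
    then obtain q where q: "q \<in> S1" "Q q = P v - Q (t i)" "norm q \<le> M * norm (P v - Q (t i))"
      using M(2) by blast
    have "norm q \<le> M * (\<epsilon> / M)"
      using q(3) v(2) mult_left_mono[of "norm (P v - Q (t i))" "\<epsilon> / M" M] M(1) by (simp add: dist_norm)
    then have "norm (t i + q - t i) \<le> \<epsilon>" using M(1) by simp
    moreover have "Q (t i + q) = P v" using q t[OF i] by (simp add: Qs)
    ultimately show ?thesis using v(1) subspace_add[OF S1 t[OF i] q(1)] by blast
  qed
  then obtain v w where "\<And>i. i < p \<Longrightarrow> v i \<in> Y \<and> w i \<in> S1 \<and> Q (w i) = P (v i) \<and> norm (w i - t i) \<le> \<epsilon>"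
    by metis
  then show thesis using that by blast
qed

text \<open>
  If \<open>P (x + \<Sum> c\<^sub>i v\<^sub>i) = Q a\<close> with \<open>a \<in> A\<close>, then \<open>a - z - \<Sum> c\<^sub>i w\<^sub>i\<close> lies in the kernel of \<open>Q\<close>, where \<open>Q z = P x\<close>; let \<open>e\<close> be its
  coordinates there. By transversality \<open>c\<close> is a Lipschitz function of \<open>e\<close>, which has only \<open>k < p\<close> components.
\<close>
lemma slice_null_preimage:
  fixes P :: "'f::topological_real_vector \<Rightarrow> 'b::real_normed_vector"
    and Q :: "'c::real_normed_vector \<Rightarrow> 'b"
  assumes Q: "surjective_linear_on S1 S Q" and b: "basis_family k b {x \<in> S1. Q x = 0}" and kp: "k < p"
    and A: "closed A" "A \<subseteq> S1" and trans: "transversal K p t A" and K: "K > 0"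
    and P: "linear_map_on UNIV S P" "continuous_on UNIV P"
    and w: "\<And>i. i < p \<Longrightarrow> w i \<in> S1" "\<And>i. i < p \<Longrightarrow> Q (w i) = P (v i)"
      "\<And>i. i < p \<Longrightarrow> norm (w i - t i) \<le> 1 / (2 * K)"
  shows "slice_null (P -` Q ` (A \<inter> cball 0 R)) p v"
  unfolding slice_null_def
proof
  fix x
  have S1: "subspace S1" and lin: "linear_map_on S1 S Q" and onto: "Q ` S1 = S"
    using Q by (auto simp: surjective_linear_on_def banach_subspace_def)
  note Qs = linear_map_on_simps[OF lin S1] and Ps = linear_map_on_simps[OF P(1) subspace_UNIV]
  obtain m where m: "m > 0" "\<And>e. m * (\<Sum>j<k. \<bar>e j\<bar>) \<le> norm (lincomb k b e)"
    using basis_coordinates_bounded[OF b] by blast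
  define Z where "Z = {c \<in> space (lborel_pow p). x + lincomb p v c \<in> P -` Q ` (A \<inter> cball 0 R)}"
  have "closed (P -` Q ` (A \<inter> cball 0 R))"
    by (rule closed_vimage[OF closed_image_bounded_part[OF Q b A] P(2)])
  then have Z: "Z \<in> sets (lborel_pow p)" unfolding Z_def by (rule slice_measurable)
  have "P x \<in> S" using P(1) by (auto simp: linear_map_on_def)
  then have "P x \<in> Q ` S1" by (simp only: onto)
  then obtain z where z: "z \<in> S1" "Q z = P x" by force
  have "\<exists>a e. a \<in> A \<and> norm a \<le> R \<and> a - z - lincomb p w c = lincomb k b e" if c: "c \<in> Z" for c
  proof -
    from c have "P (x + lincomb p v c) \<in> Q ` (A \<inter> cball 0 R)" by (simp add: Z_def)
    then obtain a where a: "a \<in> A" "norm a \<le> R" "P (x + lincomb p v c) = Q a" by force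
    have aS: "a \<in> S1" using a(1) A(2) by blast
    have wS: "lincomb p w c \<in> S1" using w(1) by (rule lincomb_in_subspace[OF S1])
    have "Q (lincomb p w c) = lincomb p (\<lambda>i. Q (w i)) c" using w(1) by (rule Qs(5))
    also have "\<dots> = lincomb p (\<lambda>i. P (v i)) c" using w(2) by (simp add: lincomb_def)
    also have "\<dots> = P (lincomb p v c)" by (rule Ps(5)[symmetric]) simp
    finally have Qw: "Q (lincomb p w c) = P (lincomb p v c)" .
    have "Q (a - z - lincomb p w c) = Q a - Q z - Q (lincomb p w c)"
      using aS z(1) wS by (simp only: Qs(3) subspace_diff[OF S1])
    also have "\<dots> = 0" unfolding a(3)[symmetric] Ps(1)[OF UNIV_I UNIV_I] z(2) Qw by simp
    finally have "Q (a - z - lincomb p w c) = 0" .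
    moreover have "a - z - lincomb p w c \<in> S1" by (intro subspace_diff[OF S1] aS z(1) wS)
    ultimately have "a - z - lincomb p w c \<in> {x \<in> S1. Q x = 0}" by simp
    with b have "\<exists>e. a - z - lincomb p w c = lincomb k b e" by (auto simp: basis_family_def)
    with a show ?thesis by blast
  qed
  then obtain a e where a: "\<And>c. c \<in> Z \<Longrightarrow> a c \<in> A" "\<And>c. c \<in> Z \<Longrightarrow> norm (a c) \<le> R"
    and e: "\<And>c. c \<in> Z \<Longrightarrow> a c - z - lincomb p w c = lincomb k b (e c)"
    by metis
  define W where "W = (\<Sum>i<p. norm (w i))"
  have W: "norm (lincomb p w c) \<le> W * (\<Sum>i<p. \<bar>c i\<bar>)" for c
    unfolding W_def by (rule norm_lincomb_le) (auto intro: member_le_sum)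
  have W0: "W \<ge> 0" by (simp add: W_def sum_nonneg)
  define B where "B = (\<Sum>j<k. norm (b j))"
  have B: "norm (lincomb k b d) \<le> B * (\<Sum>j<k. \<bar>d j\<bar>)" for d
    unfolding B_def by (rule norm_lincomb_le) (auto intro: member_le_sum)
  have B0: "B \<ge> 0" by (simp add: B_def sum_nonneg)
  \<comment> \<open>Bounded \<open>c\<close> give bounded kernel coordinates \<open>e c\<close>.\<close>
  define Zr where "Zr r = Z \<inter> {c \<in> space (lborel_pow p). (\<Sum>i<p. \<bar>c i\<bar>) \<le> real r}" for r
  have "Zr r \<in> null_sets (lborel_pow p)" for r
  proof (rule null_sets_of_lipschitz_coordinates[where k=k and e=e])
    have "(\<lambda>c. \<Sum>i<p. \<bar>c i\<bar>) \<in> borel_measurable (lborel_pow p)"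
      by (rule borel_measurable_continuous_lborel_pow, rule continuous_on_sum,
          rule continuous_on_rabs, rule continuous_on_coord)
    then show "Zr r \<in> sets (lborel_pow p)" unfolding Zr_def by (intro sets.Int Z) measurable
    show "k < p" by (rule kp)
    define E where "E = (\<bar>R\<bar> + norm z + W * r) / m"
    have E: "E \<ge> 0" using m(1) W0 by (simp add: E_def)
    then show "0 < E + 1" by simp
    show "\<bar>e c j\<bar> < E + 1" if c: "c \<in> Zr r" and j: "j < k" for c j
    proof -
      have cZ: "c \<in> Z" and cr: "(\<Sum>i<p. \<bar>c i\<bar>) \<le> r" using c by (auto simp: Zr_def)
      have "m * (\<Sum>j<k. \<bar>e c j\<bar>) \<le> norm (a c - z - lincomb p w c)"
        unfolding e[OF cZ] by (rule m(2))
      also have "\<dots> \<le> norm (a c) + norm z + norm (lincomb p w c)"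
        using norm_triangle_ineq4[of "a c - z" "lincomb p w c"] norm_triangle_ineq4[of "a c" z] by linarith
      also have "\<dots> \<le> \<bar>R\<bar> + norm z + W * r"
        using a(2)[OF cZ] W[of c] mult_left_mono[OF cr W0] by linarith
      finally have "(\<Sum>j<k. \<bar>e c j\<bar>) \<le> E" using m(1) by (simp add: E_def pos_le_divide_eq mult.commute)
      moreover have "\<bar>e c j\<bar> \<le> (\<Sum>j<k. \<bar>e c j\<bar>)" using j by (intro member_le_sum) auto
      ultimately show ?thesis by linarith
    qed
    show "0 \<le> 2 * K * B * k" using K B0 by simp
    show "\<bar>c i - c' i\<bar> \<le> 2 * K * B * k * \<delta>"
      if c: "c \<in> Zr r" "c' \<in> Zr r" and i: "i < p" and \<delta>: "\<And>j. j < k \<Longrightarrow> \<bar>e c j - e c' j\<bar> \<le> \<delta>" for c c' i \<delta>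
    proof -
      have cZ: "c \<in> Z" "c' \<in> Z" using c by (auto simp: Zr_def)
      have "a c - a c' = lincomb p w (\<lambda>i. c i - c' i) + lincomb k b (\<lambda>j. e c j - e c' j)"
        unfolding lincomb_diff e[OF cZ(1), symmetric] e[OF cZ(2), symmetric] by simp
      from transversal_perturb[OF trans K w(3) a(1)[OF cZ(1)] a(1)[OF cZ(2)] this]
      have "(\<Sum>i<p. \<bar>c i - c' i\<bar>) \<le> 2 * K * norm (lincomb k b (\<lambda>j. e c j - e c' j))" .
      also have "\<dots> \<le> 2 * K * (B * (\<Sum>j<k. \<bar>e c j - e c' j\<bar>))"
        using K B by (intro mult_left_mono) auto
      also have "(\<Sum>j<k. \<bar>e c j - e c' j\<bar>) \<le> k * \<delta>"
        using sum_bounded_above[of "{..<k}" "\<lambda>j. \<bar>e c j - e c' j\<bar>" \<delta>] \<delta> by simp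
      then have "2 * K * (B * (\<Sum>j<k. \<bar>e c j - e c' j\<bar>)) \<le> 2 * K * (B * (k * \<delta>))"
        using K B0 by (intro mult_left_mono) auto
      finally have "(\<Sum>i<p. \<bar>c i - c' i\<bar>) \<le> 2 * K * (B * (k * \<delta>))" .
      moreover have "\<bar>c i - c' i\<bar> \<le> (\<Sum>i<p. \<bar>c i - c' i\<bar>)"
        using i by (intro member_le_sum[of i "{..<p}" "\<lambda>i. \<bar>c i - c' i\<bar>"]) auto
      ultimately show ?thesis by (simp add: mult.assoc)
    qed
  qed
  then have "(\<Union>r. Zr r) \<in> null_sets (lborel_pow p)" by blast
  moreover have "(\<Union>r. Zr r) = Z"
  proof (intro equalityI subsetI)
    fix c assume c: "c \<in> Z"
    obtain r :: nat where "(\<Sum>i<p. \<bar>c i\<bar>) \<le> r" using real_arch_simple by blast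
    with c have "c \<in> Zr r" by (simp add: Zr_def Z_def)
    then show "c \<in> (\<Union>r. Zr r)" by blast
  qed (auto simp: Zr_def)
  ultimately have "Z \<in> null_sets (lborel_pow p)" by (simp only:)
  then show "{c \<in> space (lborel_pow p). x + lincomb p v c \<in> P -` Q ` (A \<inter> cball 0 R)}
      \<in> null_sets (lborel_pow p)"
    unfolding Z_def .
qed

text \<open>
  The sets \<open>C r\<close> do not depend on \<open>Y\<close>; only the directions do. Haar-nullity and meagerness use \<open>Y = UNIV\<close>, whereas
  Aronszajn-nullity needs directions in the span of each given sequence.
\<close>
lemma rectifiable_slice_null_cover:
  fixes X :: "'f::frechet_space set"
  assumes d: "d \<ge> 1"
    and X: "rectifiable TYPE('b::real_normed_vector) TYPE('c::real_normed_vector) d X"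
  shows "\<exists>C :: nat \<Rightarrow> 'f set. (\<forall>r. closed (C r)) \<and> X \<subseteq> (\<Union>r. C r) \<and>
    (\<forall>Y. closure Y = UNIV \<longrightarrow> (\<exists>p v. (\<forall>i<p. v i \<in> Y) \<and> (\<forall>r. slice_null (C r) p v)))"
proof -
  obtain S :: "'b set" and P where S: "banach_subspace S" and P: "linear_map_on UNIV S P"
    "continuous_on UNIV P" "S \<subseteq> closure (range P)" and rect: "rectifiable_banach TYPE('c) S d (P ` X)"
    using X unfolding rectifiable_def by blast
  obtain k and S1 :: "'c set" and Q A where S1: "banach_subspace S1" and Q: "fredholm S1 S Q k 0"
    and A: "lipschitz_graph S1 (d + k) A" and cover: "P ` X \<subseteq> Q ` A"
    using rect unfolding rectifiable_banach_def by blast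
  note onto = fredholm_onto[OF Q S1 S]
  have "has_finite_dim {x \<in> S1. Q x = 0} k" using Q by (simp add: fredholm_def)
  then obtain b where b: "basis_family k b {x \<in> S1. Q x = 0}" by (rule has_finite_dim_basis_family)
  obtain t K where K: "K > 0" and t: "\<And>i. i < d + k \<Longrightarrow> t i \<in> S1" and AS: "A \<subseteq> S1"
    and trans: "transversal K (d + k) t A"
    by (rule lipschitz_graph_transversal[OF A]) (rule that)
  have "closed S1" using S1 by (auto simp: banach_subspace_def complete_imp_closed)
  then have clS: "closure A \<subseteq> S1" by (rule closure_minimal[OF AS])
  define C where "C r = P -` Q ` (closure A \<inter> cball 0 (real r))" for r
  have "closed (C r)" for r
    unfolding C_def
    by (rule closed_vimage[OF closed_image_bounded_part[OF onto b closed_closure clS] P(2)])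
  moreover have "X \<subseteq> (\<Union>r. C r)"
  proof
    fix x assume "x \<in> X"
    then have "P x \<in> Q ` A" using cover by blast
    then obtain a where a: "a \<in> A" "P x = Q a" by force
    obtain r :: nat where "norm a \<le> r" using real_arch_simple by blast
    with a have "a \<in> closure A \<inter> cball 0 (real r)" using subsetD[OF closure_subset] by simp
    with a(2) have "x \<in> C r" unfolding C_def by blast
    then show "x \<in> (\<Union>r. C r)" by blast
  qed
  moreover have "\<exists>p v. (\<forall>i<p. v i \<in> Y) \<and> (\<forall>r. slice_null (C r) p v)" if Y: "closure Y = UNIV" for Y
  proof -
    have PS: "range P \<subseteq> S" using P(1) by (simp add: linear_map_on_def)
    have "1 / (2 * K) > 0" using K by simp
    note directions = approximate_directions[OF onto t P(2) PS P(3) Y this]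
    obtain v w where vw: "\<And>i. i < d + k \<Longrightarrow> v i \<in> Y" "\<And>i. i < d + k \<Longrightarrow> w i \<in> S1"
      "\<And>i. i < d + k \<Longrightarrow> Q (w i) = P (v i)" "\<And>i. i < d + k \<Longrightarrow> norm (w i - t i) \<le> 1 / (2 * K)"
      by (rule directions) (assumption, rule that)
    have "slice_null (C r) (d + k) v" for r
      unfolding C_def
      by (rule slice_null_preimage[OF onto b _ closed_closure clS transversal_closure[OF trans] K P(1,2) vw(2-4)])
         (use d in auto)
    with vw(1) show ?thesis by blast
  qed
  ultimately show ?thesis by blast
qed

lemma countably_rectifiable_slice_null_cover:
  fixes A :: "'f::frechet_space set"
  assumes d: "d \<ge> 1"
    and A: "countably_rectifiable TYPE('b::real_normed_vector) TYPE('c::real_normed_vector) d A"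
  obtains C :: "nat \<Rightarrow> 'f set" where "\<And>i. closed (C i)" "A \<subseteq> (\<Union>i. C i)"
    "\<And>Y i. closure Y = UNIV \<Longrightarrow> \<exists>p v. (\<forall>j<p. v j \<in> Y) \<and> slice_null (C i) p v"
proof -
  obtain F where F: "countable F" "\<And>X. X \<in> F \<Longrightarrow> rectifiable TYPE('b) TYPE('c) d X" "A = \<Union>F"
    using A unfolding countably_rectifiable_def by blast
  show thesis
  proof (cases "F = {}")
    case True
    have "slice_null {} 0 v" for v :: "nat \<Rightarrow> 'f" by (simp add: slice_null_def)
    then show thesis using True F(3) that[of "\<lambda>_. {}"] by auto
  next
    case False
    obtain C where C: "\<And>X r. X \<in> F \<Longrightarrow> closed (C X r)" "\<And>X. X \<in> F \<Longrightarrow> X \<subseteq> (\<Union>r :: nat. C X r)"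
      "\<And>X Y. X \<in> F \<Longrightarrow> closure Y = UNIV \<Longrightarrow> \<exists>p v. (\<forall>i<p. v i \<in> Y) \<and> (\<forall>r. slice_null (C X r) p v)"
      using rectifiable_slice_null_cover[OF d F(2)] by metis
    define X where "X n = from_nat_into F n" for n
    have X: "X n \<in> F" for n unfolding X_def by (rule from_nat_into[OF False])
    define E where "E n = C (X (fst (prod_decode n))) (snd (prod_decode n))" for n
    show thesis
    proof (rule that[of E])
      show "closed (E i)" for i unfolding E_def by (rule C(1)[OF X])
      show "\<exists>p v. (\<forall>j<p. v j \<in> Y) \<and> slice_null (E i) p v" if "closure Y = UNIV" for Y i
        unfolding E_def using C(3)[OF X that] by blast
      show "A \<subseteq> (\<Union>i. E i)"
      proof
        fix x assume "x \<in> A"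
        then obtain Z where Z: "Z \<in> F" "x \<in> Z" using F(3) by blast
        obtain n where n: "X n = Z"
          using from_nat_into_surj[OF F(1) Z(1)] unfolding X_def by blast
        have "x \<in> (\<Union>r. C Z r)" using C(2)[OF Z(1)] Z(2) by (rule subsetD)
        then obtain r where r: "x \<in> C Z r" by blast
        have "x \<in> E (prod_encode (n, r))" using r by (simp add: E_def n)
        then show "x \<in> (\<Union>i. E i)" by blast
      qed
    qed
  qed
qed

section \<open>Aronszajn-null sets and the conclusion\<close>

lemma span_range_finite_segment:
  assumes "x \<in> span (range f)"
  shows "\<exists>n :: nat. x \<in> span (f ` {..<n})"
  using assms
proof (induction rule: span_induct_alt)
  case base
  show ?case by (rule exI[of _ 0]) (simp add: span_0)
next
  case (step c x y)
  then obtain n i where n: "y \<in> span (f ` {..<n})" and i: "x = f i" by blast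
  have "y \<in> span (f ` {..<max n (Suc i)})"
    by (rule subsetD[OF span_mono n]) auto
  moreover have "x \<in> span (f ` {..<max n (Suc i)})"
    unfolding i by (intro span_base imageI) simp
  ultimately show ?case by (intro exI[of _ "max n (Suc i)"] span_add span_scale)
qed

lemma span_range_finite_segments:
  fixes p :: nat
  assumes "\<And>j. j < p \<Longrightarrow> v j \<in> span (range f)"
  shows "\<exists>n :: nat. \<forall>j<p. v j \<in> span (f ` {..<n})"
proof -
  have "\<exists>n. v j \<in> span (f ` {..<n})" if "j < p" for j
    using span_range_finite_segment[OF assms[OF that]] .
  then obtain N where N: "\<And>j. j < p \<Longrightarrow> v j \<in> span (f ` {..<N j})" by metis
  show ?thesis
  proof (intro exI[of _ "\<Sum>j<p. N j"] allI impI)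
    fix j assume j: "j < p"
    then have "N j \<le> (\<Sum>j<p. N j)" by (intro member_le_sum) auto
    then have "f ` {..<N j} \<subseteq> f ` {..<\<Sum>j<p. N j}" by (intro image_mono) auto
    then show "v j \<in> span (f ` {..<\<Sum>j<p. N j})" using N[OF j] by (meson span_mono subsetD)
  qed
qed

lemma slice_null_imp_aronszajn_null:
  fixes A :: "'f::frechet_space set" and C :: "nat \<Rightarrow> 'f set"
  assumes C: "\<And>i. closed (C i)" and cover: "A \<subseteq> (\<Union>i. C i)"
    and null: "\<And>Y i. closure Y = UNIV \<Longrightarrow> \<exists>p v. (\<forall>j<p. v j \<in> Y) \<and> slice_null (C i) p v"
  shows "aronszajn_null A"
  unfolding aronszajn_null_def
proof (intro allI impI)
  fix f :: "nat \<Rightarrow> 'f" assume f: "closure (span (range f)) = UNIV"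
  define good where "good i n N \<longleftrightarrow> C i \<subseteq> (\<Union>j<n. N j) \<and>
      (\<forall>j<n. N j \<in> sets borel \<and> (\<forall>x. {t::real. x + t *\<^sub>R f j \<in> N j} \<in> null_sets lebesgue))"
    for i and n :: nat and N
  have "\<exists>n N. good i n N" for i
  proof -
    obtain p v where v: "\<And>j. j < p \<Longrightarrow> v j \<in> span (range f)" and pv: "slice_null (C i) p v"
      using null[OF f] by blast
    obtain n where "\<forall>j<p. v j \<in> span (f ` {..<n})"
      using span_range_finite_segments[of p v f] v by blast
    then have "slice_null (C i) n f" by (intro slice_null_span[OF C pv]) simp
    from slice_null_decomposition[OF C this] have "\<exists>N. good i n N" unfolding good_def .
    then show ?thesis by (rule exI)
  qed
  then obtain n N where "\<And>i. good i (n i) (N i)" by metis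
  then have N: "\<And>i. C i \<subseteq> (\<Union>j<n i. N i j)"
    "\<And>i j. j < n i \<Longrightarrow> N i j \<in> sets borel"
    "\<And>i j x. j < n i \<Longrightarrow> {t::real. x + t *\<^sub>R f j \<in> N i j} \<in> null_sets lebesgue"
    unfolding good_def by simp_all
  define M where "M j = (\<Union>i\<in>{i. j < n i}. N i j)" for j
  have "M j \<in> sets borel" for j
    unfolding M_def using N(2) by (intro sets.countable_UN'') auto
  moreover have "A \<subseteq> (\<Union>j. M j)"
  proof
    fix x assume "x \<in> A"
    then obtain i where "x \<in> C i" using cover by blast
    then obtain j where "j < n i" "x \<in> N i j" using N(1) by blast
    then show "x \<in> (\<Union>j. M j)" unfolding M_def by blast
  qed
  moreover have "{t::real. x + t *\<^sub>R f j \<in> M j} \<in> null_sets lebesgue" for x j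
  proof -
    have "{t. x + t *\<^sub>R f j \<in> M j} = (\<Union>i\<in>{i. j < n i}. {t. x + t *\<^sub>R f j \<in> N i j})"
      unfolding M_def by blast
    also have "\<dots> \<in> null_sets lebesgue"
      using N(3) by (intro null_sets_UN') auto
    finally show ?thesis .
  qed
  ultimately show "\<exists>N. (\<forall>n. N n \<in> sets borel) \<and> A \<subseteq> (\<Union>n. N n) \<and>
      (\<forall>v n. {x :: real. v + x *\<^sub>R f n \<in> N n} \<in> null_sets lebesgue)" by blast
qed

theorem theorem4:
  fixes A :: "'f::frechet_space set" and d :: nat
  assumes "d \<ge> 1"
    and "countably_rectifiable TYPE('b::real_normed_vector) TYPE('c::real_normed_vector) d A"
  shows "baire_meager A \<and> haar_null A \<and>
    (separable_space (euclidean :: 'f topology) \<longrightarrow> aronszajn_null A)"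
proof -
  obtain C :: "nat \<Rightarrow> 'f set" where C: "\<And>i. closed (C i)" and cover: "A \<subseteq> (\<Union>i. C i)"
    and null: "\<And>Y i. closure Y = UNIV \<Longrightarrow> \<exists>p v. (\<forall>j<p. v j \<in> Y) \<and> slice_null (C i) p v"
    by (rule countably_rectifiable_slice_null_cover[OF assms]) (rule that)
  have "\<exists>p v. slice_null (C i) p v" for i using null[OF closure_UNIV] by blast
  then obtain p v where pv: "\<And>i. slice_null (C i) (p i) (v i)" by metis
  have "baire_meager A"
    unfolding baire_meager_def
  proof (intro exI[of _ "range C"] conjI ballI)
    fix D assume "D \<in> range C"
    then obtain i where D: "D = C i" by blast
    show "closed D" "interior D = {}" unfolding D by (rule C, rule slice_null_empty_interior[OF pv])
  qed (use cover in simp_all)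
  moreover have "haar_null A" by (rule slice_null_imp_haar_null[OF C pv cover])
  moreover have "aronszajn_null A" by (rule slice_null_imp_aronszajn_null[OF C cover null])
  ultimately show ?thesis by blast
qed

end
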